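(* Let $\mathfrak{d}\ge 2$ and let $\mathfrak{D_d}$ be the image of a fixed strong diagonalization $\Delta_{\mathfrak{d}}$ of $\mathfrak{T_d}$. Let $p\in\omega$ and let $\{F_i: i<p\}$ be a finite family of finite subsets of $\mathfrak{D_d}$ such that $F_i$ and $F_j$ are not strongly similar for $i\ne j$. Let $m_i\in\omega$ for $i<p$ and let $\gamma_i:\mathrm{Sims}_{\mathfrak{D_d}}(F_i)\to m_i$ be arbitrary colourings. Then there exists a strong similarity $g$ of $\mathfrak{D_d}$ onto a set $D\subseteq\mathfrak{D_d}$ such that each $\gamma_i$ is constant on $\mathrm{Sims}_D(F_i)$.
   Context: $\mathfrak{T_d}$ is the set of all finite sequences with entries in $\{0,\dots,\mathfrak{d}-1\}$, ordered by end-extension $\subseteq$; $|x|$ is the length of $x$, $x(i)$ its $i$-th entry, $x\wedge y$ the longest common initial segment of $x,y$. For $\subseteq$-incomparable $x,y$ write $x\prec y$ if $x(|x\wedge y|)<y(|x\wedge y|)$. A set $S\subseteq\mathfrak{T_d}$ is strongly diagonal if: it is a $\subseteq$-antichain; its closure $\{x\wedge y:x,y\in S\}$ is transversal (no two distinct elements have equal length); every element of the closure has at most two immediate successors within the closure; and for all $x,y,z\in S$ with $x\ne y$: (i) if $|x\wedge y|<|z|$ and $x\wedge y\not\subseteq z$ then $z(|x\wedge y|)=0$; (ii) $x(|x\wedge y|)\in\{0,1\}$. A strong diagonalization of $\mathfrak{T_d}$ is an injection $f:\mathfrak{T_d}\to\mathfrak{T_d}$ with strongly diagonal image such that for all $x,y,z,u$: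 $|x\wedge y|<|z\wedge u|$ implies $|f(x)\wedge f(y)|<|f(z)\wedge f(u)|$; if $|z|>|x|$ then $z(|x|)=f(z)(|f(x)|)$; and $x\prec y$ implies $f(x)\prec f(y)$. (Such maps exist.) For $R,S\subseteq\mathfrak{T_d}$, a strong similarity of $R$ to $S$ is a bijection $f:R\to S$ such that for all $x,y,z,u\in R$: $x\wedge y\subseteq z\wedge u$ iff $f(x)\wedge f(y)\subseteq f(z)\wedge f(u)$; $|x\wedge y|<|z\wedge u|$ iff $|f(x)\wedge f(y)|<|f(z)\wedge f(u)|$; and if $|z|>|x\wedge y|$ then $z(|x\wedge y|)=f(z)(|f(x)\wedge f(y)|)$. $R$ and $S$ are strongly similar if such an $f$ exists. For $T\subseteq\mathfrak{T_d}$, $\mathrm{Sims}_T(R)$ is the set of all $S\subseteq T$ strongly similar to $R$. *)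

theory Defs
  imports "HOL-Library.Sublist" "HOL-Library.FuncSet"
begin

definition Tree :: "nat \<Rightarrow> nat list set" where
  "Tree d = lists {..<d}"

abbreviation meet :: "nat list \<Rightarrow> nat list \<Rightarrow> nat list" where
  "meet \<equiv> longest_common_prefix"

definition left_of :: "nat list \<Rightarrow> nat list \<Rightarrow> bool"  (infix \<open>\<prec>\<close> 50) where
  "x \<prec> y \<longleftrightarrow> x \<parallel> y \<and> x ! length (meet x y) < y ! length (meet x y)"

definition meet_closure :: "nat list set \<Rightarrow> nat list set" where
  "meet_closure S = {meet x y | x y. x \<in> S \<and> y \<in> S}"

(* The successors are taken within C, so they may be longer than c by more than one entry. *)
definition immediate_succs :: "nat list set \<Rightarrow> nat list \<Rightarrow> nat list set" where
  "immediate_succs C c =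
     {s \<in> C. strict_prefix c s \<and> \<not> (\<exists>t \<in> C. strict_prefix c t \<and> strict_prefix t s)}"

(* Here and below, the hypotheses (being incomparable, or the conditions on lengths stated
   before it) ensure that every index lies within the list to which (!) is applied.
   Finiteness is stated separately because card is 0 on infinite sets. *)
definition strongly_diagonal :: "nat \<Rightarrow> nat list set \<Rightarrow> bool" where
  "strongly_diagonal d S \<longleftrightarrow>
     S \<subseteq> Tree d \<and>
     pairwise (\<parallel>) S \<and>
     inj_on length (meet_closure S) \<and>
     (\<forall>c \<in> meet_closure S.
        finite (immediate_succs (meet_closure S) c) \<and>
        card (immediate_succs (meet_closure S) c) \<le> 2) \<and>
     (\<forall>x \<in> S. \<forall>y \<in> S. \<forall>z \<in> S. x \<noteq> y \<longrightarrow>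
        (length (meet x y) < length z \<and> \<not> prefix (meet x y) z
           \<longrightarrow> z ! length (meet x y) = 0) \<and>
        x ! length (meet x y) \<in> {0, 1})"

definition strong_diagonalization :: "nat \<Rightarrow> (nat list \<Rightarrow> nat list) \<Rightarrow> bool" where
  "strong_diagonalization d f \<longleftrightarrow>
     f \<in> Tree d \<rightarrow> Tree d \<and>
     inj_on f (Tree d) \<and>
     strongly_diagonal d (f ` Tree d) \<and>
     (\<forall>x \<in> Tree d. \<forall>y \<in> Tree d. \<forall>z \<in> Tree d. \<forall>u \<in> Tree d.
        length (meet x y) < length (meet z u) \<longrightarrow>
        length (meet (f x) (f y)) < length (meet (f z) (f u))) \<and>
     (\<forall>x \<in> Tree d. \<forall>z \<in> Tree d.
        length x < length z \<longrightarrow> z ! length x = f z ! length (f x)) \<and>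
     (\<forall>x \<in> Tree d. \<forall>y \<in> Tree d. x \<prec> y \<longrightarrow> f x \<prec> f y)"

definition strong_similarity ::
    "(nat list \<Rightarrow> nat list) \<Rightarrow> nat list set \<Rightarrow> nat list set \<Rightarrow> bool" where
  "strong_similarity f R S \<longleftrightarrow>
     bij_betw f R S \<and>
     (\<forall>x \<in> R. \<forall>y \<in> R. \<forall>z \<in> R. \<forall>u \<in> R.
        (prefix (meet x y) (meet z u) \<longleftrightarrow>
           prefix (meet (f x) (f y)) (meet (f z) (f u))) \<and>
        (length (meet x y) < length (meet z u) \<longleftrightarrow>
           length (meet (f x) (f y)) < length (meet (f z) (f u))) \<and>
        (length (meet x y) < length z \<longrightarrow>
           z ! length (meet x y) = f z ! length (meet (f x) (f y))))"

definition strongly_similar :: "nat list set \<Rightarrow> nat list set \<Rightarrow> bool" where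
  "strongly_similar R S \<longleftrightarrow> (\<exists>f. strong_similarity f R S)"

definition Sims :: "nat list set \<Rightarrow> nat list set \<Rightarrow> nat list set set" where
  "Sims T R = {S. S \<subseteq> T \<and> strongly_similar R S}"

end

theory Submission
  imports Defs "HOL-Library.Infinite_Set"
begin

text \<open>
  Let \<open>q\<close> be an idempotent ultrafilter on left variable words (words starting with the variable)
  all of whose substitution instances \<open>q(a)\<close> lie in one minimal left ideal, so that
  \<open>q(a) q(b) = q(a)\<close>. Choosing words greedily according to \<open>q\<close> gives the Carlson--Simpson theorem
  for colourings of words; over the alphabet of \<open>n\<close>-tuples of digits this is the Halpern--Laeuchli
  theorem for \<open>n\<close> copies of the tree, and fusion yields Milliken's theorem for colourings of strong
  embeddings that depend on finitely many levels.

  Deleting all entries of a finite antichain \<open>F\<close> at levels other than those of its meets leaves a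
  set \<open>Q\<close> that depends only on the strong similarity type, and every copy of \<open>F\<close> is \<open>e ` Q\<close>
  for some strong embedding \<open>e\<close>. So Milliken's theorem provides a strong embedding \<open>\<phi>\<close> for which
  the colour of \<open>\<Delta> ` \<phi> ` S\<close> is the same for all copies \<open>S\<close> of \<open>F\<close>. Since \<open>\<Delta>\<close> is a strong
  similarity on every strongly diagonal set, \<open>g = \<Delta> \<circ> \<phi>\<close> is as required.
\<close>

subsection \<open>Idempotent filters and the Carlson--Simpson theorem\<close>

text \<open>The usual product of ultrafilters on a semigroup, extended to all filters.\<close>

definition conv :: "'a list filter \<Rightarrow> 'a list filter \<Rightarrow> 'a list filter"  (infixl \<open>\<odot>\<close> 70) where
  "F \<odot> G = Abs_filter (\<lambda>P. \<forall>\<^sub>F x in F. \<forall>\<^sub>F y in G. P (x @ y))"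

lemma eventually_conv:
  "eventually P (F \<odot> G) \<longleftrightarrow> (\<forall>\<^sub>F x in F. \<forall>\<^sub>F y in G. P (x @ y))"
  unfolding conv_def
proof (rule eventually_Abs_filter, unfold_locales)
  fix P Q :: "'a list \<Rightarrow> bool"
  assume "\<forall>\<^sub>F x in F. \<forall>\<^sub>F y in G. P (x @ y)" "\<forall>\<^sub>F x in F. \<forall>\<^sub>F y in G. Q (x @ y)"
  then show "\<forall>\<^sub>F x in F. \<forall>\<^sub>F y in G. P (x @ y) \<and> Q (x @ y)"
    by eventually_elim (rule eventually_conj)
next
  fix P Q :: "'a list \<Rightarrow> bool"
  assume "\<forall>x. P x \<longrightarrow> Q x" and P: "\<forall>\<^sub>F x in F. \<forall>\<^sub>F y in G. P (x @ y)"
  then show "\<forall>\<^sub>F x in F. \<forall>\<^sub>F y in G. Q (x @ y)"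
    by (auto elim!: eventually_mono)
qed simp

lemma conv_assoc: "(F \<odot> G) \<odot> H = F \<odot> (G \<odot> H)"
  by (simp add: filter_eq_iff eventually_conv)

lemma conv_mono:
  assumes "F \<le> F'" "G \<le> G'"
  shows "F \<odot> G \<le> F' \<odot> G'"
proof (rule filter_leI)
  fix P assume "eventually P (F' \<odot> G')"
  then have "\<forall>\<^sub>F x in F. \<forall>\<^sub>F y in G'. P (x @ y)"
    using assms(1) by (simp add: eventually_conv filter_leD)
  then show "eventually P (F \<odot> G)"
    using assms(2) by (auto simp: eventually_conv filter_leD elim!: eventually_mono)
qed

lemma conv_eq_bot_iff: "F \<odot> G = bot \<longleftrightarrow> F = bot \<or> G = bot"
  by (cases "G = bot") (simp_all add: trivial_limit_def eventually_conv)

lemma filtermap_conv: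
  assumes "\<And>x y. h (x @ y) = h x @ h y"
  shows "filtermap h (F \<odot> G) = filtermap h F \<odot> filtermap h G"
  by (simp add: filter_eq_iff eventually_conv eventually_filtermap assms)

text \<open>Residual of the product: by \<open>le_lquot_iff\<close> it is the largest filter
  \<open>Y\<close> with \<open>Y \<odot> q \<le> p\<close>. It stands for the closed set of all
  ultrafilters \<open>y\<close> with \<open>y \<odot> q \<le> p\<close>.\<close>

definition lquot :: "'a list filter \<Rightarrow> 'a list filter \<Rightarrow> 'a list filter" where
  "lquot p q = Abs_filter (\<lambda>Q. \<exists>P. eventually P p \<and> (\<forall>w. (\<forall>\<^sub>F u in q. P (w @ u)) \<longrightarrow> Q w))"

lemma eventually_lquot:
  "eventually Q (lquot p q) \<longleftrightarrow> (\<exists>P. eventually P p \<and> (\<forall>w. (\<forall>\<^sub>F u in q. P (w @ u)) \<longrightarrow> Q w))"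
  unfolding lquot_def
proof (rule eventually_Abs_filter, unfold_locales)
  fix Q R :: "'a list \<Rightarrow> bool"
  assume "\<exists>P. eventually P p \<and> (\<forall>w. (\<forall>\<^sub>F u in q. P (w @ u)) \<longrightarrow> Q w)"
    and "\<exists>P. eventually P p \<and> (\<forall>w. (\<forall>\<^sub>F u in q. P (w @ u)) \<longrightarrow> R w)"
  then obtain P P' where "eventually P p" "\<And>w. (\<forall>\<^sub>F u in q. P (w @ u)) \<Longrightarrow> Q w"
    and "eventually P' p" "\<And>w. (\<forall>\<^sub>F u in q. P' (w @ u)) \<Longrightarrow> R w"
    by blast
  then show "\<exists>P. eventually P p \<and> (\<forall>w. (\<forall>\<^sub>F u in q. P (w @ u)) \<longrightarrow> Q w \<and> R w)"
    by (intro exI[of _ "\<lambda>x. P x \<and> P' x"]) (simp add: eventually_conj_iff)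
qed (auto intro: exI[of _ "\<lambda>_. True"])

lemma le_lquot_iff: "Y \<le> lquot p q \<longleftrightarrow> Y \<odot> q \<le> p"
proof
  assume "Y \<le> lquot p q"
  then show "Y \<odot> q \<le> p"
    by (auto simp: le_filter_def eventually_conv eventually_lquot)
next
  assume *: "Y \<odot> q \<le> p"
  show "Y \<le> lquot p q"
    unfolding le_filter_def eventually_lquot
  proof safe
    fix P Q assume "eventually P p" and Q: "\<forall>w. (\<forall>\<^sub>F u in q. P (w @ u)) \<longrightarrow> Q w"
    then have "\<forall>\<^sub>F w in Y. \<forall>\<^sub>F u in q. P (w @ u)"
      using * by (simp add: le_filter_def eventually_conv)
    then show "eventually Q Y" by (rule eventually_mono) (use Q in blast)
  qed
qed

section \<open>Ultrafilters and minimal filters\<close>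

definition ultra :: "'a filter \<Rightarrow> bool" where
  "ultra p \<longleftrightarrow> p \<noteq> bot \<and> (\<forall>P. eventually P p \<or> (\<forall>\<^sub>F x in p. \<not> P x))"

lemma ultra_not_eventually:
  assumes "ultra p"
  shows "(\<forall>\<^sub>F x in p. \<not> P x) \<longleftrightarrow> \<not> eventually P p"
proof -
  have "\<not> ((\<forall>\<^sub>F x in p. \<not> P x) \<and> eventually P p)"
    using assms by (auto simp: ultra_def trivial_limit_def simp flip: eventually_conj_iff)
  with assms show ?thesis by (auto simp: ultra_def)
qed

lemma ultra_le_imp_eq:
  assumes "ultra p" "q \<le> p" "q \<noteq> bot"
  shows "q = p"
proof (rule antisym)
  show "p \<le> q"
  proof (rule filter_leI, rule ccontr)
    fix P assume P: "eventually P q" and "\<not> eventually P p"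
    then have "\<forall>\<^sub>F x in p. \<not> P x"
      using assms(1) by (simp add: ultra_not_eventually)
    then have "\<forall>\<^sub>F x in q. \<not> P x" using assms(2) by (rule filter_leD[rotated])
    with P have "\<forall>\<^sub>F x in q. False" by eventually_elim simp
    with assms(3) show False by (simp add: trivial_limit_def)
  qed
qed fact

lemma ultra_filtermap: "ultra p \<Longrightarrow> ultra (filtermap h p)"
  by (simp add: ultra_def eventually_filtermap filtermap_bot_iff)

lemma ultra_finite_range:
  assumes "ultra p" "finite (range c)"
  obtains j where "\<forall>\<^sub>F x in p. c x = j"
proof (rule ccontr)
  assume "\<not> thesis"
  then have "\<forall>j\<in>range c. \<forall>\<^sub>F x in p. c x \<noteq> j"
    using that assms(1) by (auto simp: ultra_not_eventually)
  then have "\<forall>\<^sub>F x in p. \<forall>j\<in>range c. c x \<noteq> j"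
    using assms(2) by (intro eventually_ball_finite)
  then have "\<forall>\<^sub>F x in p. False" by (rule eventually_mono) auto
  with assms(1) show False by (simp add: ultra_def)
qed

text \<open>Zorn's lemma in the role of compactness: the infimum of a chain of proper filters stays
  proper, since whatever holds eventually in it already does so in a member of the chain. Smaller
  filters correspond to smaller closed sets.\<close>

lemma minimal_filter:
  fixes F0 :: "'a filter"
  assumes "R F0" "F0 \<noteq> bot"
    and "\<And>K. K \<noteq> {} \<Longrightarrow> (\<And>F. F \<in> K \<Longrightarrow> R F) \<Longrightarrow> R (Inf K)"
  obtains F where "F \<le> F0" "F \<noteq> bot" "R F"
    "\<And>G. G \<le> F \<Longrightarrow> G \<noteq> bot \<Longrightarrow> R G \<Longrightarrow> G = F"
proof -
  define A where "A = {F. R F \<and> F \<noteq> bot \<and> F \<le> F0}"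
  have "\<exists>m\<in>A. \<forall>a\<in>A. m \<ge> a \<longrightarrow> a = m"
  proof (rule predicate_Zorn)
    show "partial_order_on A (relation_of (\<ge>) A)"
      by (auto simp: partial_order_on_def preorder_on_def refl_on_def trans_def antisym_def
          relation_of_def)
  next
    fix K assume K: "K \<in> Chains (relation_of (\<ge>) A)"
    then have KA: "K \<subseteq> A" and ch: "\<And>F G. F \<in> K \<Longrightarrow> G \<in> K \<Longrightarrow> F \<le> G \<or> G \<le> F"
      by (auto simp: Chains_def relation_of_def)
    show "\<exists>u\<in>A. \<forall>a\<in>K. a \<ge> u"
    proof (cases "K = {}")
      case True
      then show ?thesis using assms by (auto simp: A_def)
    next
      case False
      have "eventually P (Inf K) = (\<exists>b\<in>K. eventually P b)" for P
        using False ch by (intro eventually_Inf_base) (auto simp: inf_absorb1 inf_absorb2)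
      then have "Inf K \<noteq> bot"
        using KA by (auto simp: trivial_limit_def A_def)
      moreover have "R (Inf K)"
        using KA False by (intro assms(3)) (auto simp: A_def)
      moreover have "Inf K \<le> F0"
        using KA False by (auto simp: A_def intro: Inf_lower2)
      ultimately show ?thesis
        by (intro bexI[of _ "Inf K"]) (auto simp: A_def Inf_lower)
    qed
  qed
  then show thesis
    using that unfolding A_def by (metis (mono_tags, lifting) mem_Collect_eq order_trans)
qed

text \<open>A minimal proper filter decides every \<open>P\<close>: unless \<open>P\<close> is
  refuted, restricting the filter to \<open>{x. P x}\<close> keeps it proper and hence, by
  minimality, does not change it.\<close>

lemma ultra_exists:
  assumes "F \<noteq> bot"
  obtains p where "p \<le> F" "ultra p"
proof -
  obtain p where p: "p \<le> F" "p \<noteq> bot" "\<And>G. G \<le> p \<Longrightarrow> G \<noteq> bot \<Longrightarrow> G = p"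
    using minimal_filter[of "\<lambda>_. True" F] assms by auto
  have "eventually P p \<or> (\<forall>\<^sub>F x in p. \<not> P x)" for P
  proof (rule disjCI)
    assume "\<not> (\<forall>\<^sub>F x in p. \<not> P x)"
    then have "inf p (principal {x. P x}) \<noteq> bot"
      by (simp add: trivial_limit_def eventually_inf_principal)
    then have "inf p (principal {x. P x}) = p" by (intro p(3)) auto
    moreover have "eventually P (inf p (principal {x. P x}))"
      by (simp add: eventually_inf_principal)
    ultimately show "eventually P p" by simp
  qed
  with p show thesis by (intro that[of p]) (auto simp: ultra_def)
qed

text \<open>
  The Ellis--Numakura argument, carried out with filters in place of closed sets of ultrafilters:
  a filter \<open>F\<close> with \<open>F \<odot> F \<le> F\<close> plays the role of a closed subsemigroup.
\<close>

lemma idempotent_ultra: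
  assumes "F0 \<noteq> bot" "F0 \<odot> F0 \<le> F0"
  obtains p where "p \<le> F0" "ultra p" "p \<odot> p = p"
proof -
  have "Inf K \<odot> Inf K \<le> Inf K" if "\<And>F. F \<in> K \<Longrightarrow> F \<odot> F \<le> F" for K :: "'a list filter set"
    by (intro Inf_greatest order_trans[OF conv_mono that] Inf_lower)
  then obtain F where F: "F \<le> F0" "F \<noteq> bot" "F \<odot> F \<le> F"
    and min: "\<And>G. G \<le> F \<Longrightarrow> G \<noteq> bot \<Longrightarrow> G \<odot> G \<le> G \<Longrightarrow> G = F"
    by (rule minimal_filter[of "\<lambda>F. F \<odot> F \<le> F" F0, OF assms(2,1)]) (assumption | rule that)+
  obtain p where p: "p \<le> F" "ultra p" using ultra_exists F(2) by blast
  then have "p \<noteq> bot" by (simp add: ultra_def)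
  \<comment> \<open>The product is again a closed subsemigroup inside \<open>F\<close>, so
    minimality makes it all of \<open>F\<close>.\<close>
  have Fp: "F \<odot> p = F"
  proof (rule min)
    show "F \<odot> p \<le> F" using conv_mono[OF order_refl p(1)] F(3) by (rule order_trans)
    show "F \<odot> p \<noteq> bot" using F \<open>p \<noteq> bot\<close> by (simp add: conv_eq_bot_iff)
    have "p \<odot> F \<le> F" using conv_mono[OF p(1) order_refl] F(3) by (rule order_trans)
    then have "F \<odot> (p \<odot> F) \<odot> p \<le> F \<odot> F \<odot> p" by (simp add: conv_mono)
    also have "\<dots> \<le> F \<odot> p" using F(3) by (simp add: conv_mono)
    finally show "F \<odot> p \<odot> (F \<odot> p) \<le> F \<odot> p" by (simp add: conv_assoc)
  qed
  \<comment> \<open>The closed set of all \<open>x\<close> below \<open>F\<close> with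
    \<open>x \<odot> p = p\<close>. It is nonempty because \<open>F \<odot> p = F\<close> lies above
    \<open>p\<close>, and it is again a subsemigroup.\<close>
  define G where "G = inf F (lquot p p)"
  have "G = F"
  proof (rule min)
    show "G \<le> F" by (simp add: G_def)
    show "G \<noteq> bot"
    proof
      assume "G = bot"
      then obtain Q R where Q: "eventually Q F" and R: "eventually R (lquot p p)"
        and QR: "\<And>x. Q x \<Longrightarrow> R x \<Longrightarrow> False"
        by (auto simp: G_def trivial_limit_def eventually_inf)
      from R obtain P where P: "eventually P p" "\<And>w. (\<forall>\<^sub>F u in p. P (w @ u)) \<Longrightarrow> R w"
        by (auto simp: eventually_lquot)
      have "\<forall>\<^sub>F w in F. \<forall>\<^sub>F u in p. \<not> P (w @ u)"
        using Q
      proof (rule eventually_mono)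
        fix w assume "Q w"
        then have "\<not> (\<forall>\<^sub>F u in p. P (w @ u))" using P(2) QR by blast
        then show "\<forall>\<^sub>F u in p. \<not> P (w @ u)" using p(2) by (simp add: ultra_not_eventually)
      qed
      then have "\<forall>\<^sub>F x in F. \<not> P x" by (subst Fp[symmetric]) (simp add: eventually_conv)
      then have "\<forall>\<^sub>F x in p. \<not> P x" by (rule filter_leD[OF p(1)])
      with P(1) p(2) show False by (simp add: ultra_not_eventually)
    qed
    have "G \<odot> p \<le> p" by (simp add: G_def flip: le_lquot_iff)
    then have "G \<odot> (G \<odot> p) \<le> G \<odot> p" "G \<odot> p \<le> p" by (simp_all add: conv_mono)
    then have "G \<odot> G \<odot> p \<le> p" by (simp add: conv_assoc)
    then have "G \<odot> G \<le> lquot p p" by (simp add: le_lquot_iff)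
    moreover have "G \<odot> G \<le> F" using conv_mono[of G F G F] F(3) by (auto simp: G_def)
    ultimately show "G \<odot> G \<le> G" by (simp add: G_def)
  qed
  \<comment> \<open>Together with \<open>F \<odot> p = F\<close> this puts \<open>F\<close> below
    \<open>p\<close>, so \<open>F = p\<close>, and \<open>Fp\<close> becomes the idempotence of
    \<open>p\<close>.\<close>
  then have "F \<odot> p \<le> p" by (metis G_def inf.cobounded2 le_lquot_iff)
  with Fp p(1) have "F = p" by simp
  with Fp F(1) p(2) show thesis by (intro that[of p]) auto
qed

text \<open>
  A filter \<open>F\<close> with \<open>top \<odot> F \<le> F\<close> plays the role of a closed left ideal.
\<close>

lemma minimal_left_ideal:
  obtains F :: "'a list filter" where "F \<noteq> bot" "top \<odot> F \<le> F"
    "\<And>p q. p \<le> F \<Longrightarrow> q \<le> F \<Longrightarrow> ultra p \<Longrightarrow> ultra q \<Longrightarrow> q \<odot> q = q \<Longrightarrow> p \<odot> q = p"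
proof -
  have left_ideal_Inf: "top \<odot> Inf K \<le> Inf K" if "\<And>F. F \<in> K \<Longrightarrow> top \<odot> F \<le> F" for K :: "'a list filter set"
    by (intro Inf_greatest order_trans[OF conv_mono that] Inf_lower order_refl)
  have top: "(top :: 'a list filter) \<noteq> bot" by (simp add: trivial_limit_def)
  obtain F :: "'a list filter" where F: "F \<noteq> bot" "top \<odot> F \<le> F"
    and min: "\<And>G. G \<le> F \<Longrightarrow> G \<noteq> bot \<Longrightarrow> top \<odot> G \<le> G \<Longrightarrow> G = F"
    by (rule minimal_filter[of "\<lambda>F. top \<odot> F \<le> F" top, OF top_greatest top left_ideal_Inf])
      (assumption | rule that)+
  show thesis
  proof (rule that[of F])
    fix p q assume pq: "p \<le> F" "q \<le> F" "ultra p" "ultra q" "q \<odot> q = q"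
    then have nb: "p \<noteq> bot" "q \<noteq> bot" by (auto simp: ultra_def)
    \<comment> \<open>The left ideal generated by \<open>q\<close> lies inside the minimal left
      ideal \<open>F\<close>, so it is all of \<open>F\<close>.\<close>
    have "top \<odot> q = F"
    proof (rule min)
      show "top \<odot> q \<le> F" using conv_mono[OF order_refl pq(2)] F(2) by (rule order_trans)
      show "top \<odot> q \<noteq> bot" using nb top by (simp add: conv_eq_bot_iff)
      show "top \<odot> (top \<odot> q) \<le> top \<odot> q" by (simp add: conv_mono flip: conv_assoc)
    qed
    \<comment> \<open>Stands for all solutions of \<open>y \<odot> q = p\<close>. Once it is proper,
      multiplying by the idempotent \<open>q\<close> again gives
      \<open>p \<odot> q = p\<close>.\<close>
    define y where "y = lquot p q"
    have "y \<noteq> bot"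
    proof
      assume "y = bot"
      then obtain P where P: "eventually P p" "\<And>w. \<not> (\<forall>\<^sub>F u in q. P (w @ u))"
        by (auto simp: y_def trivial_limit_def eventually_lquot)
      then have "\<forall>\<^sub>F x in top \<odot> q. \<not> P x"
        using pq(4) by (simp add: eventually_conv ultra_not_eventually)
      then have "\<forall>\<^sub>F x in p. \<not> P x" using pq(1) \<open>top \<odot> q = F\<close> by (simp add: filter_leD)
      with P(1) pq(3) show False by (simp add: ultra_not_eventually)
    qed
    moreover have "y \<odot> q \<le> p" by (simp add: y_def flip: le_lquot_iff)
    ultimately have "y \<odot> q = p" using pq(3) nb by (simp add: ultra_le_imp_eq conv_eq_bot_iff)
    then show "p \<odot> q = p" using pq(5) by (metis conv_assoc)
  qed fact+
qed

section \<open>Variable words and greedy choice along an ultrafilter\<close>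

definition left_variable :: "'b option list \<Rightarrow> bool" where
  "left_variable u \<longleftrightarrow> (\<exists>r. u = None # r)"

text \<open>\<open>None\<close> is the variable and \<open>Some b\<close> the letter
  \<open>b\<close>.\<close>

definition subst :: "'b \<Rightarrow> 'b option list \<Rightarrow> 'b list" where
  "subst a = map (case_option a id)"

definition subst_seq :: "(nat \<Rightarrow> 'b option list) \<Rightarrow> 'b list \<Rightarrow> 'b list" where
  "subst_seq u xs = concat (map (\<lambda>k. subst (xs ! k) (u k)) [0..<length xs])"

lemma subst_seq_snoc: "subst_seq u (xs @ [a]) = subst_seq u xs @ subst a (u (length xs))"
  by (auto simp: subst_seq_def nth_append intro!: arg_cong[of _ _ concat])

theorem carlson_simpson:
  fixes c :: "'b list \<Rightarrow> 'c"
  assumes "finite (range c)" "finite B"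
  obtains w u j where "\<And>n::nat. left_variable (u n)"
    "\<And>xs. set xs \<subseteq> B \<Longrightarrow> c (w @ subst_seq u xs) = j"
proof -
  obtain F0 :: "'b list filter" where F0: "F0 \<noteq> bot" "top \<odot> F0 \<le> F0"
    and absorb: "\<And>p q. p \<le> F0 \<Longrightarrow> q \<le> F0 \<Longrightarrow> ultra p \<Longrightarrow> ultra q \<Longrightarrow> q \<odot> q = q \<Longrightarrow> p \<odot> q = p"
    using minimal_left_ideal by blast
  \<comment> \<open>Left variable words ending in a constant word from \<open>F0\<close>.
    Substituting a letter sends \<open>G\<close> below \<open>F0\<close>, because \<open>F0\<close>
    absorbs factors on its left.\<close>
  define G where "G = principal {[None]} \<odot> (top \<odot> filtermap (map Some) F0)"
  have "G \<odot> G \<le> G"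
  proof -
    \<comment> \<open>Everything between the leading variable and the last factor is absorbed by
      \<open>top\<close>.\<close>
    have "G \<odot> G = principal {[None]} \<odot>
        ((top \<odot> filtermap (map Some) F0 \<odot> principal {[None]} \<odot> top) \<odot> filtermap (map Some) F0)"
      by (simp add: G_def conv_assoc)
    also have "\<dots> \<le> G" unfolding G_def by (intro conv_mono order_refl top_greatest)
    finally show ?thesis .
  qed
  moreover have "G \<noteq> bot"
    using F0(1) by (simp add: G_def conv_eq_bot_iff filtermap_bot_iff principal_eq_bot_iff
        trivial_limit_def[of top])
  ultimately obtain q where q: "q \<le> G" "ultra q" "q \<odot> q = q"
    using idempotent_ultra by blast
  define s where "s a = filtermap (subst a) q" for a
  have hom: "subst a (x @ y) = subst a x @ subst a y" for a :: 'b and x y by (simp add: subst_def)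
  have ult: "ultra (s a)" for a by (simp add: s_def ultra_filtermap q)
  have idem: "s a \<odot> s a = s a" for a
    by (simp add: s_def hom q(3) flip: filtermap_conv)
  have le: "s a \<le> F0" for a
  proof -
    have "(subst a \<circ> map Some) x = x" for x :: "'b list" by (simp add: subst_def o_def)
    then have *: "filtermap (subst a) (filtermap (map Some) F0) = F0"
      by (simp add: filtermap_filtermap filter_eq_iff eventually_filtermap)
    have "s a \<le> filtermap (subst a) G" unfolding s_def by (rule filtermap_mono) fact
    also have "\<dots> \<le> top \<odot> (top \<odot> F0)"
      by (simp add: G_def filtermap_conv hom * conv_mono)
    also have "\<dots> \<le> top \<odot> F0" using F0(2) by (simp add: conv_mono)
    also have "\<dots> \<le> F0" by fact
    finally show ?thesis .
  qed
  \<comment> \<open>All instances of \<open>q\<close> are idempotent ultrafilters in the same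
    minimal left ideal.\<close>
  have ab: "s a \<odot> s b = s a" for a b
    using absorb[OF le le ult ult idem] .
  \<comment> \<open>The letter is arbitrary and need not lie in \<open>B\<close>: by
    \<open>ab\<close>, \<open>p \<odot> s a = p\<close> for every letter \<open>a\<close>.\<close>
  define p where "p = s undefined"
  obtain j where j: "\<forall>\<^sub>F x in p. c x = j"
    using ultra_finite_range[OF _ assms(1)] ult p_def by metis
  \<comment> \<open>The greedy invariant: besides having colour \<open>j\<close>, the word keeps
    this colour under substitution instances of most next words.\<close>
  define good where "good x \<longleftrightarrow> c x = j \<and> (\<forall>a\<in>B. \<forall>\<^sub>F u in q. c (x @ subst a u) = j)" for x
  have ev_s: "eventually P (s a) \<longleftrightarrow> (\<forall>\<^sub>F u in q. P (subst a u))" for P a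
    by (simp add: s_def eventually_filtermap)
  have "\<forall>\<^sub>F x in p. \<forall>\<^sub>F u in q. c (x @ subst a u) = j" for a
  proof -
    have "\<forall>\<^sub>F x in p \<odot> s a. c x = j" using j by (simp add: p_def ab)
    then show ?thesis by (simp add: eventually_conv ev_s)
  qed
  then have "\<forall>\<^sub>F x in p. good x"
    unfolding good_def using j assms(2) by (simp add: eventually_conj eventually_ball_finite)
  then obtain w where w: "good w"
    using ult[of undefined] unfolding p_def ultra_def by (metis eventually_happens)
  \<comment> \<open>By \<open>ab\<close>, what holds for most instances of \<open>q\<close> at
    \<open>a\<close> also holds for most products of such an instance with one at \<open>b\<close>.
    Thus most continuations of a good word can be continued once more.\<close>
  have step: "\<forall>\<^sub>F u in q. good (x @ subst a u)" if "good x" "a \<in> B" for x a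
  proof -
    have 1: "\<forall>\<^sub>F u in q. c (x @ subst a u) = j" using that by (simp add: good_def)
    then have "\<forall>\<^sub>F y in s a. c (x @ y) = j" by (simp add: ev_s)
    then have "\<forall>\<^sub>F y in s a \<odot> s b. c (x @ y) = j" for b by (simp add: ab)
    then have "\<forall>\<^sub>F u in q. \<forall>\<^sub>F u' in q. c ((x @ subst a u) @ subst b u') = j" for b
      by (simp add: eventually_conv ev_s)
    then show ?thesis
      unfolding good_def using 1 assms(2) by (simp add: eventually_conj eventually_ball_finite)
  qed
  have left: "\<forall>\<^sub>F u in q. left_variable u"
    by (rule filter_leD[OF q(1)]) (simp add: left_variable_def G_def eventually_conv[of _ "principal _"] eventually_principal)
  have ext: "\<exists>u. left_variable u \<and> (\<forall>x\<in>X. \<forall>a\<in>B. good (x @ subst a u))"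
    if "finite X" "\<forall>x\<in>X. good x" for X
  proof -
    have "\<forall>x\<in>X. \<forall>a\<in>B. \<forall>\<^sub>F u in q. good (x @ subst a u)" using step that(2) by blast
    then have "\<forall>\<^sub>F u in q. \<forall>x\<in>X. \<forall>a\<in>B. good (x @ subst a u)"
      using that(1) assms(2) by (intro eventually_ball_finite ballI) auto
    with left have "\<forall>\<^sub>F u in q. left_variable u \<and> (\<forall>x\<in>X. \<forall>a\<in>B. good (x @ subst a u))"
      by (rule eventually_conj)
    then show ?thesis
      using q(2) by (auto simp: ultra_def dest: eventually_happens)
  qed
  \<comment> \<open>\<open>X n\<close> is a finite set of good words that contains all results of
    \<open>n\<close> substitutions after \<open>w\<close>. Finiteness lets one word \<open>u\<close>
    serve all of them at the same time.\<close>
  have "\<exists>X. \<forall>n. (finite (X n) \<and> (\<forall>x\<in>X n. good x) \<and> (n = 0 \<longrightarrow> w \<in> X n)) \<and>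
      (\<exists>u. left_variable u \<and> (\<forall>x\<in>X n. \<forall>a\<in>B. x @ subst a u \<in> X (Suc n)))"
  proof (rule dependent_nat_choice)
    show "\<exists>X. finite X \<and> (\<forall>x\<in>X. good x) \<and> ((0::nat) = 0 \<longrightarrow> w \<in> X)"
      using w by (intro exI[of _ "{w}"]) simp
  next
    fix X and n :: nat assume X: "finite X \<and> (\<forall>x\<in>X. good x) \<and> (n = 0 \<longrightarrow> w \<in> X)"
    then have "\<exists>u. left_variable u \<and> (\<forall>x\<in>X. \<forall>a\<in>B. good (x @ subst a u))"
      by (intro ext) simp_all
    then obtain u where u: "left_variable u" "\<forall>x\<in>X. \<forall>a\<in>B. good (x @ subst a u)"
      by blast
    have "finite ((\<lambda>(x, a). x @ subst a u) ` (X \<times> B))" using X assms(2) by simp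
    then show "\<exists>Y. (finite Y \<and> (\<forall>x\<in>Y. good x) \<and> (Suc n = 0 \<longrightarrow> w \<in> Y)) \<and>
       (\<exists>u. left_variable u \<and> (\<forall>x\<in>X. \<forall>a\<in>B. x @ subst a u \<in> Y))"
      using u by (intro exI[of _ "(\<lambda>(x, a). x @ subst a u) ` (X \<times> B)"] conjI exI[of _ u]) auto
  qed
  then obtain X where X: "\<And>n x. x \<in> X n \<Longrightarrow> good x" "w \<in> X 0"
    and ex: "\<forall>n. \<exists>u. left_variable u \<and> (\<forall>x\<in>X n. \<forall>a\<in>B. x @ subst a u \<in> X (Suc n))"
    by blast
  from choice[OF ex] obtain u where u: "\<And>n. left_variable (u n)"
    "\<And>n x a. x \<in> X n \<Longrightarrow> a \<in> B \<Longrightarrow> x @ subst a (u n) \<in> X (Suc n)"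
    by blast
  show thesis
  proof (rule that[OF u(1)])
    fix xs assume "set xs \<subseteq> B"
    then have "w @ subst_seq u xs \<in> X (length xs)"
    proof (induction xs rule: rev_induct)
      case Nil then show ?case using X(2) by (simp add: subst_seq_def)
    next
      case (snoc a xs)
      then show ?case using u(2)[of "w @ subst_seq u xs"] by (simp add: subst_seq_snoc)
    qed
    then show "c (w @ subst_seq u xs) = j" using X(1) good_def by blast
  qed
qed

subsection \<open>Strong embeddings and the Halpern--Laeuchli theorem\<close>

text \<open>Parametrizes Milliken's strong subtrees: \<open>l\<close> is the level function, and the
  digit right after an image is the digit of the successor that was taken.\<close>

definition strong_emb :: "nat \<Rightarrow> (nat \<Rightarrow> nat) \<Rightarrow> (nat list \<Rightarrow> nat list) \<Rightarrow> bool" where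
  "strong_emb d l f \<longleftrightarrow> (\<forall>x\<in>Tree d. f x \<in> Tree d \<and> length (f x) = l (length x) \<and>
     (\<forall>a<d. prefix (f x @ [a]) (f (x @ [a]))))"

section \<open>Sequences of digits and their meets\<close>

lemma Nil_in_Tree [simp]: "[] \<in> Tree d"
  and append_in_Tree [simp]: "xs @ ys \<in> Tree d \<longleftrightarrow> xs \<in> Tree d \<and> ys \<in> Tree d"
  and Cons_in_Tree [simp]: "a # xs \<in> Tree d \<longleftrightarrow> a < d \<and> xs \<in> Tree d"
  by (auto simp: Tree_def)

lemma concat_in_Tree [simp]: "concat xss \<in> Tree d \<longleftrightarrow> (\<forall>xs\<in>set xss. xs \<in> Tree d)"
  by (induction xss) auto

lemma replicate_in_Tree [simp]: "a < d \<Longrightarrow> replicate n a \<in> Tree d"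
  by (induction n) auto

lemma take_in_Tree [simp]: "x \<in> Tree d \<Longrightarrow> take n x \<in> Tree d"
  and drop_in_Tree [simp]: "x \<in> Tree d \<Longrightarrow> drop n x \<in> Tree d"
  using append_in_Tree[of "take n x" "drop n x"] by simp_all

lemma prefix_in_Tree: "prefix x y \<Longrightarrow> y \<in> Tree d \<Longrightarrow> x \<in> Tree d"
  by (auto simp: prefix_def)

lemma nth_Tree: "x \<in> Tree d \<Longrightarrow> i < length x \<Longrightarrow> x ! i < d"
  by (auto simp: Tree_def in_lists_conv_set)

lemma finite_Tree_length: "finite {x \<in> Tree d. length x < n}"
proof -
  have "{x \<in> Tree d. length x < n} \<subseteq> (\<Union>k<n. {x. set x \<subseteq> {..<d} \<and> length x = k})"
    by (auto simp: Tree_def)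
  then show ?thesis by (rule finite_subset) (simp add: finite_lists_length_eq)
qed

lemma meet_append_neq [simp]: "a \<noteq> b \<Longrightarrow> meet (m @ a # x) (m @ b # y) = m"
  by (induction m) auto

lemma meet_commute: "meet x y = meet y x"
  by (meson longest_common_prefix_max_prefix longest_common_prefix_prefix1
      longest_common_prefix_prefix2 prefix_order.antisym)

lemma meet_prefix: "prefix x y \<Longrightarrow> meet x y = x"
  by (meson longest_common_prefix_max_prefix longest_common_prefix_prefix1 prefix_order.antisym
      prefix_order.order_refl)

section \<open>Meets, levels and digits under strong embeddings\<close>

lemma strong_embD:
  assumes "strong_emb d l f" "x \<in> Tree d"
  shows "f x \<in> Tree d" "length (f x) = l (length x)"
    "a < d \<Longrightarrow> prefix (f x @ [a]) (f (x @ [a]))"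
  using assms by (auto simp: strong_emb_def)

lemma strong_emb_prefix:
  assumes f: "strong_emb d l f" and "prefix x y" "y \<in> Tree d"
  shows "prefix (f x) (f y)"
proof -
  obtain z where "y = x @ z" using assms(2) by (auto simp: prefix_def)
  moreover have "x @ z \<in> Tree d \<Longrightarrow> prefix (f x) (f (x @ z))"
  proof (induction z rule: rev_induct)
    case (snoc a z)
    then have "prefix (f (x @ z) @ [a]) (f (x @ z @ [a]))"
      using strong_embD(3)[OF f, of "x @ z" a] by simp
    then show ?case using snoc by (auto dest: append_prefixD intro: prefix_order.order_trans)
  qed simp
  ultimately show ?thesis using assms(3) by simp
qed

text \<open>If \<open>x\<close> and \<open>y\<close> split at \<open>m\<close>, their images
  continue \<open>f m\<close> with the same two different digits and so split exactly at
  \<open>f m\<close>.\<close>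

lemma strong_emb_meet:
  assumes f: "strong_emb d l f" and xy: "x \<in> Tree d" "y \<in> Tree d"
  shows "meet (f x) (f y) = f (meet x y)"
proof -
  consider "prefix x y" | "prefix y x" | "x \<parallel> y" by blast
  then show ?thesis
  proof cases
    case 3
    then obtain m a x' b y' where *: "a \<noteq> b" "x = m @ a # x'" "y = m @ b # y'"
      using parallel_decomp[OF 3] by blast
    have m: "m \<in> Tree d" "a < d" "b < d" using * xy by auto
    have "prefix (f m @ [a]) (f x)" "prefix (f m @ [b]) (f y)"
      using * strong_emb_prefix[OF f _ xy(1), of "m @ [a]"] strong_emb_prefix[OF f _ xy(2), of "m @ [b]"]
        strong_embD(3)[OF f m(1,2)] strong_embD(3)[OF f m(1,3)]
      by (auto elim: prefix_order.order_trans)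
    then obtain u v where "f x = f m @ a # u" "f y = f m @ b # v"
      by (auto simp: prefix_def)
    with * show ?thesis by simp
  next
    case 1
    then show ?thesis using strong_emb_prefix[OF f 1 xy(2)] by (simp add: meet_prefix)
  next
    case 2
    then show ?thesis using strong_emb_prefix[OF f 2 xy(1)]
      by (simp add: meet_prefix meet_commute[of x] meet_commute[of "f x"])
  qed
qed

lemma meet_in_Tree [simp]: "x \<in> Tree d \<Longrightarrow> meet x y \<in> Tree d"
  using prefix_in_Tree longest_common_prefix_prefix1 by blast

lemma strong_emb_strict_mono:
  assumes f: "strong_emb d l f" and d: "0 < d"
  shows "strict_mono l"
  unfolding strict_mono_Suc_iff
proof
  fix n
  have "prefix (f (replicate n 0) @ [0]) (f (replicate n 0 @ [0]))"
    using d by (intro strong_embD(3)[OF f]) auto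
  then have "length (f (replicate n 0)) < length (f (replicate n 0 @ [0]))"
    by (auto dest: prefix_length_le)
  then show "l n < l (Suc n)" using d by (simp add: strong_embD(2)[OF f])
qed

text \<open>Equal images force \<open>f (meet x y) = f x = f y\<close>; comparing levels,
  \<open>meet x y\<close> is as long as \<open>x\<close> and as \<open>y\<close>.\<close>

lemma strong_emb_inj:
  assumes f: "strong_emb d l f" and d: "0 < d"
  shows "inj_on f (Tree d)"
proof (rule inj_onI)
  fix x y assume xy: "x \<in> Tree d" "y \<in> Tree d" "f x = f y"
  then have "f (meet x y) = f x" using strong_emb_meet[OF f xy(1,2)] by (simp add: meet_prefix)
  then have "l (length (meet x y)) = l (length x)" "l (length (meet x y)) = l (length y)"
    using xy by (metis meet_in_Tree strong_embD(2)[OF f])+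
  then have "length (meet x y) = length x" "length (meet x y) = length y"
    using strong_emb_strict_mono[OF f d] by (simp_all add: strict_mono_eq)
  moreover have "u = v" if "prefix u v" "length u = length v" for u v :: "nat list"
    using that by (auto simp: prefix_def)
  ultimately show "x = y"
    by (metis longest_common_prefix_prefix1 longest_common_prefix_prefix2)
qed

lemma strong_emb_nth:
  assumes f: "strong_emb d l f" and z: "z \<in> Tree d" "n < length z"
  shows "f z ! l n = z ! n"
proof -
  have "prefix (f (take n z) @ [z ! n]) (f (take n z @ [z ! n]))"
    using z by (intro strong_embD(3)[OF f]) (auto simp: nth_Tree)
  also have "prefix \<dots> (f z)"
    using z by (intro strong_emb_prefix[OF f]) (simp_all add: take_is_prefix flip: take_Suc_conv_app_nth)
  finally obtain u where "f z = f (take n z) @ z ! n # u" by (auto simp: prefix_def)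
  moreover have "length (f (take n z)) = l n" using z by (simp add: strong_embD(2)[OF f])
  ultimately show ?thesis by (metis nth_append_length)
qed

lemma strong_emb_id: "strong_emb d id id"
  by (simp add: strong_emb_def)

lemma strong_emb_comp:
  assumes f: "strong_emb d l f" and g: "strong_emb d l' g"
  shows "strong_emb d (l \<circ> l') (f \<circ> g)"
  unfolding strong_emb_def
proof safe
  fix x a assume x: "x \<in> Tree d"
  have gx: "g x \<in> Tree d" "length (g x) = l' (length x)" using strong_embD[OF g x] by auto
  show "(f \<circ> g) x \<in> Tree d" "length ((f \<circ> g) x) = (l \<circ> l') (length x)"
    using strong_embD[OF f gx(1)] gx(2) by auto
  assume a: "a < d"
  have "prefix (f (g x) @ [a]) (f (g x @ [a]))" using strong_embD[OF f gx(1)] a by auto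
  also have "prefix \<dots> (f (g (x @ [a])))"
    using x a by (intro strong_emb_prefix[OF f] strong_embD[OF g]) auto
  finally show "prefix ((f \<circ> g) x @ [a]) ((f \<circ> g) (x @ [a]))" by simp
qed

text \<open>Every level has a node, such as the one with all digits 0, and the length of its image
  is the value of the level function.\<close>

lemma strong_emb_length_cong:
  assumes "strong_emb d l f" "strong_emb d l' f'" "0 < d"
    and "\<And>x. x \<in> Tree d \<Longrightarrow> length x = n \<Longrightarrow> f x = f' x"
  shows "l n = l' n"
  using assms(4)[of "replicate n 0"] strong_embD(2)[OF assms(1), of "replicate n 0"]
    strong_embD(2)[OF assms(2), of "replicate n 0"] assms(3) by simp

text \<open>
  The Halpern--Laeuchli theorem for homogeneous trees is the Carlson--Simpson theorem over the
  alphabet of tuples: substituting the coordinates of a letter into a left variable word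
  coordinatewise yields strong embeddings with a common level function.
\<close>

theorem halpern_laeuchli:
  fixes c :: "('i \<Rightarrow> nat list) \<Rightarrow> 'c"
  assumes d: "0 < d" and I: "finite I" and c: "finite (range c)"
  obtains \<Phi> l j where "\<And>i. strong_emb d l (\<Phi> i)"
    "\<forall>t n. (\<forall>i. t i \<in> Tree d \<and> length (t i) = n) \<longrightarrow> c (restrict (\<lambda>i. \<Phi> i (t i)) I) = j"
proof -
  \<comment> \<open>The letters of \<open>w\<close> and \<open>u\<close> need not come from
    \<open>B\<close>, so \<open>mod d\<close> is what keeps all projected digits below
    \<open>d\<close>.\<close>
  define pr where "pr i = map (\<lambda>b :: 'i \<Rightarrow> nat. b i mod d)" for i
  \<comment> \<open>Projects a variable word to coordinate \<open>i\<close> and puts the digit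
    \<open>a\<close> for the variable.\<close>
  define ps where "ps i a = map (case_option a (\<lambda>b :: 'i \<Rightarrow> nat. b i mod d))" for i and a :: nat
  define B where "B = (I \<rightarrow>\<^sub>E {..<d})"
  have "range (\<lambda>W. c (restrict (\<lambda>i. pr i W) I)) \<subseteq> range c" by auto
  then have "finite (range (\<lambda>W. c (restrict (\<lambda>i. pr i W) I)))"
    using c by (rule finite_subset)
  moreover have "finite B" using I by (simp add: B_def finite_PiE)
  ultimately obtain w u j where u: "\<And>n::nat. left_variable (u n)"
    and j: "\<And>xs. set xs \<subseteq> B \<Longrightarrow> c (restrict (\<lambda>i. pr i (w @ subst_seq u xs)) I) = j"
    using carlson_simpson[of "\<lambda>W. c (restrict (\<lambda>i. pr i W) I)" B] by metis
  define \<Phi> where "\<Phi> i x = pr i w @ concat (map (\<lambda>k. ps i (x ! k) (u k)) [0..<length x])" for i x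
  define l where "l n = length w + length (concat (map u [0..<n]))" for n
  have snoc: "\<Phi> i (x @ [a]) = \<Phi> i x @ ps i a (u (length x))" for i x a
    by (auto simp: \<Phi>_def nth_append intro!: arg_cong[of _ _ concat])
  have "strong_emb d l (\<Phi> i)" for i
    unfolding strong_emb_def
  proof safe
    fix x a assume x: "x \<in> Tree d"
    have "ps i a v \<in> Tree d" if "a < d" for a v
      using that d by (auto simp: ps_def Tree_def in_lists_conv_set split: option.split)
    moreover have "pr i v \<in> Tree d" for v
      using d by (auto simp: pr_def Tree_def in_lists_conv_set)
    ultimately show "\<Phi> i x \<in> Tree d" using x by (auto simp: \<Phi>_def nth_Tree)
    show "length (\<Phi> i x) = l (length x)"
      by (simp add: \<Phi>_def l_def pr_def ps_def length_concat o_def)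
    assume "a < d"
    \<comment> \<open>As \<open>u (length x)\<close> starts with the variable, the first digit
      appended is \<open>a\<close> itself.\<close>
    show "prefix (\<Phi> i x @ [a]) (\<Phi> i (x @ [a]))"
      using u[of "length x"] by (auto simp: snoc left_variable_def ps_def)
  qed
  moreover have "c (restrict (\<lambda>i. \<Phi> i (t i)) I) = j"
    if t: "\<And>i. t i \<in> Tree d \<and> length (t i) = n" for t n
  proof -
    \<comment> \<open>The \<open>k\<close>-th letter is the tuple of the \<open>k\<close>-th digits
      of all coordinates.\<close>
    define xs where "xs = map (\<lambda>k. restrict (\<lambda>i. t i ! k) I) [0..<n]"
    have "set xs \<subseteq> B" using t by (auto simp: xs_def B_def nth_Tree)
    moreover have "pr i (w @ subst_seq u xs) = \<Phi> i (t i)" if "i \<in> I" for i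
    proof -
      have "pr i (subst b v) = ps i (b i mod d) v" for b v
        by (auto simp: pr_def ps_def subst_def split: option.split)
      moreover have "(xs ! k) i mod d = t i ! k" if "k < n" for k
        using that t[of i] \<open>i \<in> I\<close> by (simp add: xs_def nth_Tree)
      moreover have "pr i (concat ys) = concat (map (pr i) ys)" for ys
        by (simp add: pr_def map_concat)
      moreover have "pr i (x @ y) = pr i x @ pr i y" for x y by (simp add: pr_def)
      moreover have "length xs = n" "length (t i) = n" using t by (simp_all add: xs_def)
      ultimately show ?thesis
        by (auto simp: subst_seq_def \<Phi>_def o_def intro!: arg_cong[of _ _ concat])
    qed
    then have "restrict (\<lambda>i. pr i (w @ subst_seq u xs)) I = restrict (\<lambda>i. \<Phi> i (t i)) I"
      by (rule restrict_ext)
    ultimately show ?thesis using j by metis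
  qed
  ultimately show thesis by (intro that[of l \<Phi> j]) auto
qed

subsection \<open>Milliken's theorem\<close>

definition emb :: "nat \<Rightarrow> (nat list \<Rightarrow> nat list) set" where
  "emb d = {f. \<exists>l. strong_emb d l f}"

lemma id_in_emb: "id \<in> emb d"
  unfolding emb_def using strong_emb_id by blast

lemma emb_comp: "f \<in> emb d \<Longrightarrow> g \<in> emb d \<Longrightarrow> f \<circ> g \<in> emb d"
  unfolding emb_def using strong_emb_comp by blast

text \<open>
  The values of \<open>e\<close> below \<open>x\<close> determine \<open>base_node e x\<close>, while \<open>e x\<close> can be any extension of it.
\<close>

definition base_level :: "(nat \<Rightarrow> nat) \<Rightarrow> nat \<Rightarrow> nat" where
  "base_level l k = (case k of 0 \<Rightarrow> 0 | Suc k' \<Rightarrow> Suc (l k'))"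

definition base_node :: "(nat list \<Rightarrow> nat list) \<Rightarrow> nat list \<Rightarrow> nat list" where
  "base_node e x = (if x = [] then [] else e (butlast x) @ [last x])"

lemma base_node:
  assumes e: "strong_emb d l e" and x: "x \<in> Tree d"
  shows "base_node e x \<in> Tree d" "length (base_node e x) = base_level l (length x)"
    "prefix (base_node e x) (e x)"
proof -
  have "base_node e x \<in> Tree d \<and> length (base_node e x) = base_level l (length x) \<and>
    prefix (base_node e x) (e x)"
  proof (cases x rule: rev_cases)
    case (snoc y a)
    then show ?thesis using x strong_embD[OF e, of y] by (simp add: base_node_def base_level_def)
  qed (simp add: base_node_def base_level_def)
  then show "base_node e x \<in> Tree d" "length (base_node e x) = base_level l (length x)"
    "prefix (base_node e x) (e x)" by auto
qed

lemma base_node_inj: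
  assumes e: "strong_emb d l e" and d: "0 < d" and x: "x \<in> Tree d" "y \<in> Tree d"
    and "length x = length y" "base_node e x = base_node e y"
  shows "x = y"
proof (cases x rule: rev_cases)
  case (snoc x' a)
  with assms(5) obtain y' b where "y = y' @ [b]" by (cases y rule: rev_cases) auto
  with snoc assms strong_emb_inj[OF e d] show ?thesis
    by (auto simp: base_node_def dest: inj_onD)
qed (use assms in auto)

text \<open>
  One step of the fusion: \<open>\<psi>\<close> is the identity below level \<open>n\<close>, and above every node of level \<open>n\<close>
  it is given by the Halpern--Laeuchli theorem applied to all these nodes at once.
\<close>

lemma fusion_step:
  fixes c :: "(nat list \<Rightarrow> nat list) \<Rightarrow> 'c"
  assumes d: "0 < d" and c: "finite (range c)"
    and local: "\<And>e e'. e \<in> emb d \<Longrightarrow> e' \<in> emb d \<Longrightarrow>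
      (\<And>x. x \<in> Tree d \<Longrightarrow> length x \<le> k \<Longrightarrow> e x = e' x) \<Longrightarrow> c e = c e'"
  obtains \<psi> where "\<psi> \<in> emb d" "\<And>x. x \<in> Tree d \<Longrightarrow> length x < n \<Longrightarrow> \<psi> x = x"
    "\<And>e e' l l'. strong_emb d l e \<Longrightarrow> strong_emb d l' e' \<Longrightarrow>
       base_level l k = n \<Longrightarrow> base_level l' k = n \<Longrightarrow>
       (\<And>x. x \<in> Tree d \<Longrightarrow> length x < k \<Longrightarrow> e x = e' x) \<Longrightarrow> c (\<psi> \<circ> e) = c (\<psi> \<circ> e')"
proof -
  define low where "low = {x \<in> Tree d. length x < k}"
  define I where "I = {x \<in> Tree d. length x = n}"
  \<comment> \<open>All possible behaviours below level \<open>k\<close> of embeddings whose base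
    nodes on level \<open>k\<close> have length \<open>n\<close>; there are only finitely
    many.\<close>
  define E where "E = (\<lambda>e. restrict e low) ` {e. \<exists>l. strong_emb d l e \<and> base_level l k = n}"
  \<comment> \<open>Completes such a behaviour: on level \<open>k\<close> the base node
    \<open>s\<close> is prolonged by \<open>t s\<close>, and all later digits are copied. By
    \<open>local\<close> the choice above level \<open>k\<close> does not affect the colour.\<close>
  define ext where "ext e t x = (if length x < k then e x
    else let s = base_node e (take k x) in s @ t s @ drop k x)"
    for e and t :: "nat list \<Rightarrow> nat list" and x
  \<comment> \<open>A single colouring of tuples records the colours for all members of
    \<open>E\<close> at once, so one homogeneous family serves every behaviour.\<close>
  define col where "col t = restrict (\<lambda>e. c (ext e t)) E" for t
  have "E \<subseteq> low \<rightarrow>\<^sub>E {x \<in> Tree d. length x < n}"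
  proof (clarsimp simp: E_def)
    fix e l x assume e: "strong_emb d l e" and n: "n = base_level l k" and x: "x \<in> low"
    then obtain k' where k': "k = Suc k'" by (cases k) (auto simp: low_def)
    have "l (length x) \<le> l k'"
      using strong_emb_strict_mono[OF e d] x k' by (simp add: strict_mono_less_eq low_def)
    then show "e x \<in> Tree d \<and> length (e x) < base_level l k"
      using x strong_embD[OF e, of x] k' by (simp add: base_level_def low_def)
  qed
  then have "finite E"
    by (rule finite_subset) (simp add: finite_PiE low_def finite_Tree_length)
  have "finite (E \<rightarrow>\<^sub>E range c)" using \<open>finite E\<close> c by (intro finite_PiE) auto
  then have "finite (range col)"
    by (rule finite_subset[rotated]) (auto simp: col_def)
  have "finite I"
    by (rule finite_subset[OF _ finite_Tree_length[of d "Suc n"]]) (auto simp: I_def)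
  obtain \<Psi> l0 j where \<Psi>: "\<And>i. strong_emb d l0 (\<Psi> i)"
    and j: "\<forall>t n. (\<forall>i. t i \<in> Tree d \<and> length (t i) = n) \<longrightarrow>
      col (restrict (\<lambda>i. \<Psi> i (t i)) I) = j"
    by (rule halpern_laeuchli[OF d \<open>finite I\<close> \<open>finite (range col)\<close>]) (rule that)
  define \<psi> where "\<psi> x = (if length x < n then x else take n x @ \<Psi> (take n x) (drop n x))" for x
  have "strong_emb d (\<lambda>m. if m < n then m else n + l0 (m - n)) \<psi>"
    unfolding strong_emb_def
  proof safe
    fix x a assume x: "x \<in> Tree d"
    show "\<psi> x \<in> Tree d" "length (\<psi> x) = (if length x < n then length x else n + l0 (length x - n))"
      using x strong_embD(1,2)[OF \<Psi>, of "drop n x" "take n x"] by (auto simp: \<psi>_def)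
    assume "a < d"
    then show "prefix (\<psi> x @ [a]) (\<psi> (x @ [a]))"
      using x strong_embD(3)[OF \<Psi>, of "drop n x" a "take n x"] by (auto simp: \<psi>_def)
  qed
  then have \<psi>: "\<psi> \<in> emb d" by (auto simp: emb_def)
  have key: "c (\<psi> \<circ> e) = j (restrict e low)" if e: "strong_emb d l e" and n: "base_level l k = n" for e l
  proof -
    have eE: "restrict e low \<in> E" using e n by (auto simp: E_def)
    have le: "length (e x) < n" if "x \<in> low" for x
    proof -
      from that obtain k' where k': "k = Suc k'" by (cases k) (auto simp: low_def)
      have "l (length x) \<le> l k'"
        using strong_emb_strict_mono[OF e d] that k' by (simp add: strict_mono_less_eq low_def)
      then show ?thesis using n that strong_embD[OF e, of x] k' by (auto simp: base_level_def low_def)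
    qed
    define P where "P s x \<longleftrightarrow> x \<in> Tree d \<and> length x = k \<and> base_node e x = s" for s x
    \<comment> \<open>What \<open>e\<close> adds to its base nodes on level \<open>k\<close>. Other
      nodes of length \<open>n\<close> receive zeros of the same length, because the homogeneous
      family needs a tuple from a single level.\<close>
    define t where "t s = (if \<exists>x. P s x then drop n (e (THE x. P s x)) else replicate (l k - n) 0)" for s
    have t: "t (base_node e x) = drop n (e x)" if "x \<in> Tree d" "length x = k" for x
    proof -
      have "(THE y. P (base_node e x) y) = x"
        using that base_node_inj[OF e d] by (auto simp: P_def)
      then show ?thesis using that by (auto simp: t_def P_def)
    qed
    have tT: "t s \<in> Tree d \<and> length (t s) = l k - n" for s
    proof (cases "\<exists>x. P s x")
      case True
      then obtain x where "P s x" by blast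
      then show ?thesis using t[of x] strong_embD[OF e, of x] by (auto simp: P_def)
    next
      case False then show ?thesis using d by (simp add: t_def)
    qed
    define t' where "t' = restrict (\<lambda>i. \<Psi> i (t i)) I"
    have bn: "base_node (restrict e low) x = base_node e x" if "x \<in> Tree d" "length x = k" for x
      using that by (cases x rule: rev_cases) (auto simp: base_node_def low_def)
    have bnI: "base_node e x \<in> I" if "x \<in> Tree d" "length x = k" for x
      using that base_node[OF e, of x] n by (auto simp: I_def)
    have t'T: "t' s \<in> Tree d \<and> length (t' s) = l0 (l k - n)" if "s \<in> I" for s
      using that tT[of s] strong_embD(1,2)[OF \<Psi>, of "t s" s] by (auto simp: t'_def)
    let ?e = "ext (restrict e low) t'"
    have ext_high: "?e x = base_node e (take k x) @ t' (base_node e (take k x)) @ drop k x"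
      if "x \<in> Tree d" "\<not> length x < k" for x
      using that by (simp add: ext_def bn Let_def)
    have "strong_emb d (\<lambda>m. if m < k then l m else n + l0 (l k - n) + (m - k)) ?e"
      unfolding strong_emb_def
    proof safe
      fix x a assume x: "x \<in> Tree d"
      have "length (?e x) = (if length x < k then l (length x)
        else n + l0 (l k - n) + (length x - k)) \<and> ?e x \<in> Tree d"
      proof (cases "length x < k")
        case True
        then show ?thesis using x strong_embD[OF e x] by (simp add: ext_def low_def)
      next
        case False
        then show ?thesis
          using x bnI[of "take k x"] t'T[of "base_node e (take k x)"]
          by (auto simp: ext_high I_def)
      qed
      then show "length (?e x) = (if length x < k then l (length x)
        else n + l0 (l k - n) + (length x - k))" "?e x \<in> Tree d" by auto
      assume a: "a < d"
      consider "Suc (length x) < k" | "Suc (length x) = k" | "k \<le> length x" by linarith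
      then show "prefix (?e x @ [a]) (?e (x @ [a]))"
      proof cases
        case 1
        then show ?thesis using x a strong_embD(3)[OF e x a] by (simp add: ext_def low_def)
      next
        case 2
        then have "?e x = e x" using x by (simp add: ext_def low_def)
        with 2 show ?thesis using x a by (simp add: ext_high base_node_def)
      next
        case 3
        then show ?thesis using x a by (simp add: ext_high)
      qed
    qed
    then have "?e \<in> emb d" by (auto simp: emb_def)
    moreover have "\<psi> \<circ> e \<in> emb d" using \<psi> e by (auto simp: emb_def intro: emb_comp[unfolded emb_def, simplified])
    \<comment> \<open>Up to level \<open>k\<close>, \<open>\<psi>\<close> just replaces each
      addition \<open>t s\<close> by its image under the homogeneous family, so the colour is an
      entry of \<open>j\<close>.\<close>
    moreover have "(\<psi> \<circ> e) x = ?e x" if x: "x \<in> Tree d" "length x \<le> k" for x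
    proof (cases "length x < k")
      case True
      then show ?thesis using x le[of x] by (simp add: ext_def low_def \<psi>_def)
    next
      case False
      with x have k: "length x = k" by simp
      note b = base_node[OF e x(1)]
      from b(3) obtain r where r: "e x = base_node e x @ r" by (auto simp: prefix_def)
      have "length (base_node e x) = n" using b(2) n k by simp
      then have "take n (e x) = base_node e x" "\<not> length (e x) < n" using r by simp_all
      then have "\<psi> (e x) = base_node e x @ t' (base_node e x)"
        using t[OF x(1) k] bnI[OF x(1) k] by (simp add: \<psi>_def t'_def)
      then show ?thesis using x k by (simp add: ext_high)
    qed
    ultimately have "c (\<psi> \<circ> e) = c ?e" by (intro local) auto
    also have "\<dots> = col t' (restrict e low)" using eE by (simp add: col_def)
    also have "col t' = j" unfolding t'_def using j tT by blast
    finally show ?thesis .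
  qed
  show thesis
  proof (rule that[OF \<psi>])
    show "\<psi> x = x" if "length x < n" for x using that by (simp add: \<psi>_def)
    fix e e' l l'
    assume "strong_emb d l e" "strong_emb d l' e'" "base_level l k = n" "base_level l' k = n"
      and eq: "\<And>x. x \<in> Tree d \<Longrightarrow> length x < k \<Longrightarrow> e x = e' x"
    moreover have "restrict e low = restrict e' low"
      using eq by (auto simp: low_def restrict_def)
    ultimately show "c (\<psi> \<circ> e) = c (\<psi> \<circ> e')" by (simp add: key)
  qed
qed

text \<open>\<open>fusion_step\<close> treats embeddings with one base level \<open>n\<close>.
  Composing its maps for all \<open>n\<close> treats every embedding; since the \<open>n\<close>-th
  map fixes all nodes below level \<open>n\<close>, the compositions stabilize at each node.\<close>

lemma fusion:
  fixes c :: "(nat list \<Rightarrow> nat list) \<Rightarrow> 'c"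
  assumes d: "0 < d" and c: "finite (range c)"
    and local: "\<And>e e'. e \<in> emb d \<Longrightarrow> e' \<in> emb d \<Longrightarrow>
      (\<And>x. x \<in> Tree d \<Longrightarrow> length x \<le> k \<Longrightarrow> e x = e' x) \<Longrightarrow> c e = c e'"
  shows "\<exists>\<phi>\<in>emb d. \<forall>e\<in>emb d. \<forall>e'\<in>emb d.
    (\<forall>x\<in>Tree d. length x < k \<longrightarrow> e x = e' x) \<longrightarrow> c (\<phi> \<circ> e) = c (\<phi> \<circ> e')"
proof -
  \<comment> \<open>\<open>\<psi>\<close> is a fusion step at \<open>n\<close> for the colouring
    already shifted by the composition \<open>\<Phi>\<close> of the earlier steps.\<close>
  define good where "good n \<Phi> \<psi> \<longleftrightarrow> \<psi> \<in> emb d \<and> (\<forall>x\<in>Tree d. length x < n \<longrightarrow> \<psi> x = x) \<and>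
    (\<forall>e e' l l'. strong_emb d l e \<and> strong_emb d l' e' \<and> base_level l k = n \<and> base_level l' k = n \<and>
       (\<forall>x\<in>Tree d. length x < k \<longrightarrow> e x = e' x) \<longrightarrow> c (\<Phi> \<circ> (\<psi> \<circ> e)) = c (\<Phi> \<circ> (\<psi> \<circ> e')))" for n \<Phi> \<psi>
  have ex: "\<exists>\<psi>. good n \<Phi> \<psi>" if \<Phi>: "\<Phi> \<in> emb d" for n \<Phi>
  proof -
    have "finite (range (\<lambda>e. c (\<Phi> \<circ> e)))" using c by (rule finite_subset[rotated]) auto
    moreover have "c (\<Phi> \<circ> e) = c (\<Phi> \<circ> e')" if "e \<in> emb d" "e' \<in> emb d"
      "\<And>x. x \<in> Tree d \<Longrightarrow> length x \<le> k \<Longrightarrow> e x = e' x" for e e'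
      using that \<Phi> by (intro local emb_comp) auto
    ultimately show ?thesis
    proof (rule fusion_step[OF d, where k = k and n = n])
      fix \<psi>
      assume *: "\<psi> \<in> emb d" "\<And>x. x \<in> Tree d \<Longrightarrow> length x < n \<Longrightarrow> \<psi> x = x"
        "\<And>e e' l l'. strong_emb d l e \<Longrightarrow> strong_emb d l' e' \<Longrightarrow>
           base_level l k = n \<Longrightarrow> base_level l' k = n \<Longrightarrow>
           (\<And>x. x \<in> Tree d \<Longrightarrow> length x < k \<Longrightarrow> e x = e' x) \<Longrightarrow> c (\<Phi> \<circ> (\<psi> \<circ> e)) = c (\<Phi> \<circ> (\<psi> \<circ> e'))"
      have "good n \<Phi> \<psi>"
        unfolding good_def
      proof (intro conjI allI impI)
        show "\<psi> \<in> emb d" "\<forall>x\<in>Tree d. length x < n \<longrightarrow> \<psi> x = x" using * by auto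
      next
        fix e e' l l'
        assume "strong_emb d l e \<and> strong_emb d l' e' \<and> base_level l k = n \<and> base_level l' k = n \<and>
          (\<forall>x\<in>Tree d. length x < k \<longrightarrow> e x = e' x)"
        then show "c (\<Phi> \<circ> (\<psi> \<circ> e)) = c (\<Phi> \<circ> (\<psi> \<circ> e'))" by (intro *(3)[of l e l' e']) auto
      qed
      then show ?thesis by blast
    qed
  qed
  define step where "step n \<Phi> = (SOME \<psi>. good n \<Phi> \<psi>)" for n \<Phi>
  have step: "good n \<Phi> (step n \<Phi>)" if "\<Phi> \<in> emb d" for n \<Phi>
    unfolding step_def using ex[OF that] by (rule someI_ex)
  define S where "S = rec_nat id (\<lambda>n \<Phi>. \<Phi> \<circ> step n \<Phi>)"
  have S_Suc: "S (Suc n) = S n \<circ> step n (S n)" for n by (simp add: S_def)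
  have S: "S n \<in> emb d" for n
  proof (induction n)
    case 0
    show ?case unfolding S_def by (simp only: nat.rec id_in_emb)
  next
    case (Suc n)
    then show ?case using step[OF Suc, of n] unfolding S_Suc good_def by (intro emb_comp) auto
  qed
  define \<psi> where "\<psi> n = step n (S n)" for n
  have good: "good n (S n) (\<psi> n)" for n unfolding \<psi>_def by (rule step[OF S])
  have S_Suc: "S (Suc n) = S n \<circ> \<psi> n" for n by (simp add: S_Suc \<psi>_def)
  \<comment> \<open>From index \<open>Suc (length x)\<close> on, every further factor fixes
    \<open>x\<close>.\<close>
  define \<phi> where "\<phi> x = S (Suc (length x)) x" for x
  have stable: "S m x = \<phi> x" if "x \<in> Tree d" "Suc (length x) \<le> m" for m x
    using that(2)
  proof (induction m rule: dec_induct)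
    case base show ?case by (simp add: \<phi>_def)
  next
    case (step m)
    then show ?case using good[of m] that(1) by (simp add: S_Suc good_def)
  qed
  have "\<forall>n. \<exists>l. strong_emb d l (S n)" using S by (simp add: emb_def)
  from choice[OF this] obtain lev where lev: "\<And>n. strong_emb d (lev n) (S n)" by blast
  have "strong_emb d (\<lambda>m. lev (Suc m) m) \<phi>"
    unfolding strong_emb_def
  proof safe
    fix x a assume x: "x \<in> Tree d"
    show "\<phi> x \<in> Tree d" "length (\<phi> x) = lev (Suc (length x)) (length x)"
      using strong_embD(1,2)[OF lev x] by (simp_all add: \<phi>_def)
    assume "a < d"
    then have "prefix (S (Suc (Suc (length x))) x @ [a]) (S (Suc (Suc (length x))) (x @ [a]))"
      by (rule strong_embD(3)[OF lev x])
    then show "prefix (\<phi> x @ [a]) (\<phi> (x @ [a]))"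
      using stable[OF x, of "Suc (Suc (length x))"] by (simp add: \<phi>_def)
  qed
  then have \<phi>: "\<phi> \<in> emb d" by (auto simp: emb_def)
  \<comment> \<open>The factors after the \<open>n\<close>-th fix all nodes up to level
    \<open>n\<close>. Moving them into the embedding therefore keeps its base level
    \<open>n\<close>.\<close>
  have tail: "\<exists>r l. strong_emb d l r \<and> (\<forall>x\<in>Tree d. length x \<le> n \<longrightarrow> r x = x) \<and>
      S (Suc n + m) = S (Suc n) \<circ> r" for n m
  proof (induction m)
    case 0
    have "S (Suc n + 0) = S (Suc n) \<circ> id" by simp
    then show ?case using strong_emb_id by (metis id_apply)
  next
    case (Suc m)
    then obtain r l where r: "strong_emb d l r" "\<forall>x\<in>Tree d. length x \<le> n \<longrightarrow> r x = x"
      "S (Suc n + m) = S (Suc n) \<circ> r" by blast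
    from good[of "Suc n + m"] obtain l' where l': "strong_emb d l' (\<psi> (Suc n + m))"
      by (auto simp: good_def emb_def)
    have "S (Suc n + Suc m) = S (Suc n) \<circ> (r \<circ> \<psi> (Suc n + m))"
      using r(3) S_Suc[of "Suc n + m"] by (simp add: comp_assoc)
    moreover have "\<forall>x\<in>Tree d. length x \<le> n \<longrightarrow> (r \<circ> \<psi> (Suc n + m)) x = x"
      using r(2) good[of "Suc n + m"] by (simp add: good_def)
    ultimately show ?case using strong_emb_comp[OF r(1) l'] by blast
  qed
  show ?thesis
  proof (intro bexI[OF _ \<phi>] ballI impI)
    fix e e' assume "e \<in> emb d" "e' \<in> emb d"
      and eq: "\<forall>x\<in>Tree d. length x < k \<longrightarrow> e x = e' x"
    then obtain l l' where e: "strong_emb d l e" and e': "strong_emb d l' e'"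
      by (auto simp: emb_def)
    define n where "n = base_level l k"
    have n': "base_level l' k = n"
      using strong_emb_length_cong[OF e e' d] eq by (auto simp: n_def base_level_def split: nat.split)
    \<comment> \<open>Exceeds the lengths of all images of nodes up to level \<open>k\<close> under
      \<open>e\<close> and \<open>e'\<close>, so there \<open>S M\<close> agrees with
      \<open>\<phi>\<close>.\<close>
    define M where "M = Suc n + (l k + l' k)"
    obtain r lr where r: "strong_emb d lr r" "\<And>x. x \<in> Tree d \<Longrightarrow> length x \<le> n \<Longrightarrow> r x = x"
      and SM: "S M = S (Suc n) \<circ> r"
      using tail[of n "l k + l' k"] unfolding M_def by blast
    have lr: "lr i = i" if "i \<le> n" for i
      using strong_emb_length_cong[OF r(1) strong_emb_id d, of i] r(2) that by simp
    have cM: "c (\<phi> \<circ> f) = c (S n \<circ> (\<psi> n \<circ> (r \<circ> f)))" if f: "strong_emb d h f" "h k < M" for f h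
    proof -
      have fe: "f \<in> emb d" using f by (auto simp: emb_def)
      have "c (\<phi> \<circ> f) = c (S M \<circ> f)"
      proof (intro local emb_comp \<phi> S fe)
        fix x assume x: "x \<in> Tree d" "length x \<le> k"
        then have "length (f x) < M"
          using f strong_emb_strict_mono[OF f(1) d] strong_embD(2)[OF f(1) x(1)]
          by (metis le_less_trans strict_mono_less_eq)
        then show "(\<phi> \<circ> f) x = (S M \<circ> f) x"
          using stable[of "f x" M] strong_embD(1)[OF f(1) x(1)] by simp
      qed
      then show ?thesis by (simp add: SM S_Suc comp_assoc)
    qed
    have base: "base_level (lr \<circ> h) k = n" if "base_level h k = n" for h
      using that lr by (auto simp: base_level_def split: nat.splits)
    have "c (S n \<circ> (\<psi> n \<circ> (r \<circ> e))) = c (S n \<circ> (\<psi> n \<circ> (r \<circ> e')))"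
      using good[of n, unfolded good_def] strong_emb_comp[OF r(1) e] strong_emb_comp[OF r(1) e']
        base[of l] base[OF n'] n_def eq by (metis comp_apply)
    then show "c (\<phi> \<circ> e) = c (\<phi> \<circ> e')"
      using cM[OF e] cM[OF e'] by (simp add: M_def)
  qed
qed

text \<open>Each use of \<open>fusion\<close> removes the top level on which the colour depends; at
  \<open>k = 0\<close> no level is left and the colour is constant.\<close>

theorem milliken:
  fixes c :: "(nat list \<Rightarrow> nat list) \<Rightarrow> 'c"
  assumes d: "0 < d" and "finite (range c)"
    and "\<And>e e'. e \<in> emb d \<Longrightarrow> e' \<in> emb d \<Longrightarrow>
      (\<And>x. x \<in> Tree d \<Longrightarrow> length x < k \<Longrightarrow> e x = e' x) \<Longrightarrow> c e = c e'"
  shows "\<exists>\<phi>\<in>emb d. \<exists>j. \<forall>e\<in>emb d. c (\<phi> \<circ> e) = j"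
  using assms(2,3)
proof (induction k arbitrary: c)
  case 0
  have "c (id \<circ> e) = c id" if "e \<in> emb d" for e
    using that id_in_emb emb_comp by (intro 0(2)) blast+
  then show ?case using id_in_emb by blast
next
  case (Suc k)
  have "c e = c e'" if "e \<in> emb d" "e' \<in> emb d"
    "\<And>x. x \<in> Tree d \<Longrightarrow> length x \<le> k \<Longrightarrow> e x = e' x" for e e'
    using that by (intro Suc.prems(2)) auto
  then obtain \<phi> where \<phi>: "\<phi> \<in> emb d"
    and c: "\<forall>e\<in>emb d. \<forall>e'\<in>emb d. (\<forall>x\<in>Tree d. length x < k \<longrightarrow> e x = e' x) \<longrightarrow>
      c (\<phi> \<circ> e) = c (\<phi> \<circ> e')"
    using fusion[OF d Suc.prems(1), of k] by blast
  have "finite (range (\<lambda>e. c (\<phi> \<circ> e)))" using Suc.prems(1) by (rule finite_subset[rotated]) auto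
  then have "\<exists>\<phi>'\<in>emb d. \<exists>j. \<forall>e\<in>emb d. c (\<phi> \<circ> (\<phi>' \<circ> e)) = j"
    by (rule Suc.IH) (use c in blast)
  then obtain \<phi>' j where "\<phi>' \<in> emb d" "\<forall>e\<in>emb d. c (\<phi> \<circ> (\<phi>' \<circ> e)) = j"
    by blast
  then have "\<forall>e\<in>emb d. c ((\<phi> \<circ> \<phi>') \<circ> e) = j" by (simp only: comp_assoc)
  then show ?case using emb_comp[OF \<phi> \<open>\<phi>' \<in> emb d\<close>] by blast
qed

subsection \<open>Similarities and envelopes\<close>

text \<open>Contains the lengths of the elements themselves, as the meets with
  \<open>x = y\<close>.\<close>

definition levels :: "nat list set \<Rightarrow> nat set" where
  "levels S = {length (meet x y) | x y. x \<in> S \<and> y \<in> S}"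

section \<open>Lengths of meets and the ultrametric inequality\<close>

lemma meet_self [simp]: "meet x x = x"
  by (simp add: meet_prefix)

lemma length_meet_less:
  assumes "x \<parallel> y"
  shows "length (meet x y) < length x" "length (meet x y) < length y"
    "x ! length (meet x y) \<noteq> y ! length (meet x y)"
  using parallel_decomp[OF assms] by auto

lemma nth_less_meet:
  assumes "i < length (meet x y)"
  shows "x ! i = y ! i"
  using assms longest_common_prefix_prefix1[of x y] longest_common_prefix_prefix2[of x y]
  by (metis nth_append prefix_def)

lemma prefix_meet_iff:
  "prefix (meet x y) z \<longleftrightarrow> length (meet x y) \<le> length (meet x z)"
proof
  assume "prefix (meet x y) z"
  then show "length (meet x y) \<le> length (meet x z)"
    by (simp add: longest_common_prefix_max_prefix longest_common_prefix_prefix1 prefix_length_le)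
next
  assume "length (meet x y) \<le> length (meet x z)"
  then have "prefix (meet x y) (meet x z)"
    by (meson longest_common_prefix_prefix1 prefix_length_prefix)
  then show "prefix (meet x y) z"
    by (meson longest_common_prefix_prefix2 prefix_order.order_trans)
qed

text \<open>Expresses the prefix relation between meets by lengths of meets, so that
  \<open>strong_similarityI\<close> gets the prefix clause from the length clause.\<close>

lemma prefix_meet_meet_iff:
  "prefix (meet x y) (meet z u) \<longleftrightarrow>
     length (meet x y) \<le> length (meet x z) \<and> length (meet x y) \<le> length (meet z u)"
  unfolding prefix_meet_iff[symmetric]
  by (meson longest_common_prefix_prefix1 prefix_length_le prefix_length_prefix
      prefix_order.order_trans)

lemma less_meet_iff:
  "n < length (meet x y) \<longleftrightarrow> n < length x \<and> n < length y \<and> take (Suc n) x = take (Suc n) y"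
proof
  assume n: "n < length (meet x y)"
  obtain u v where "x = meet x y @ u" "y = meet x y @ v"
    using longest_common_prefix_prefix1[of x y] longest_common_prefix_prefix2[of x y]
    by (auto simp: prefix_def)
  then have "length x = length (meet x y) + length u" "length y = length (meet x y) + length v"
    "take (Suc n) x = take (Suc n) (meet x y)" "take (Suc n) y = take (Suc n) (meet x y)"
    using n by (metis length_append take_append append_Nil2 Suc_leI diff_is_0_eq take_0)+
  then show "n < length x \<and> n < length y \<and> take (Suc n) x = take (Suc n) y" using n by simp
next
  assume *: "n < length x \<and> n < length y \<and> take (Suc n) x = take (Suc n) y"
  then have "prefix (take (Suc n) x) (meet x y)"
    by (metis longest_common_prefix_max_prefix take_is_prefix)
  with * show "n < length (meet x y)" by (auto dest: prefix_length_le)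
qed

lemma meet_ultrametric:
  "n < length (meet x y) \<Longrightarrow> n < length (meet y z) \<Longrightarrow> n < length (meet x z)"
  by (simp add: less_meet_iff)

lemma less_meet_if_nth_eq:
  assumes "n \<le> length (meet x y)" "n < length x" "n < length y" "x ! n = y ! n"
  shows "n < length (meet x y)"
proof (rule ccontr)
  assume "\<not> n < length (meet x y)"
  then have n: "n = length (meet x y)" using assms(1) by simp
  then have "\<not> prefix x y" "\<not> prefix y x"
    using assms(2,3) by (metis meet_prefix meet_commute nat_neq_iff)+
  then show False using length_meet_less(3)[of x y] assms(4) n by (auto simp: parallel_def)
qed

section \<open>Strong similarities, their composites and inverses\<close>

lemma strong_similarityI:
  assumes "inj_on f R"
    and len: "\<And>x y z u. x \<in> R \<Longrightarrow> y \<in> R \<Longrightarrow> z \<in> R \<Longrightarrow> u \<in> R \<Longrightarrow>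
      length (meet x y) < length (meet z u) \<longleftrightarrow> length (meet (f x) (f y)) < length (meet (f z) (f u))"
    and "\<And>x y z. x \<in> R \<Longrightarrow> y \<in> R \<Longrightarrow> z \<in> R \<Longrightarrow> length (meet x y) < length z \<Longrightarrow>
      z ! length (meet x y) = f z ! length (meet (f x) (f y))"
  shows "strong_similarity f R (f ` R)"
  unfolding strong_similarity_def
proof (intro conjI ballI)
  fix x y z u assume R: "x \<in> R" "y \<in> R" "z \<in> R" "u \<in> R"
  have "length (meet x y) \<le> length (meet v w) \<longleftrightarrow>
      length (meet (f x) (f y)) \<le> length (meet (f v) (f w))" if "v \<in> R" "w \<in> R" for v w
    using len[OF that R(1,2)] by linarith
  then show "prefix (meet x y) (meet z u) \<longleftrightarrow> prefix (meet (f x) (f y)) (meet (f z) (f u))"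
    using R by (simp add: prefix_meet_meet_iff)
qed (use assms in \<open>auto simp: inj_on_imp_bij_betw\<close>)

lemma strong_similarityD:
  assumes "strong_similarity f R S"
  shows "inj_on f R" "f ` R = S"
    "\<And>x y z u. x \<in> R \<Longrightarrow> y \<in> R \<Longrightarrow> z \<in> R \<Longrightarrow> u \<in> R \<Longrightarrow>
      length (meet x y) < length (meet z u) \<longleftrightarrow> length (meet (f x) (f y)) < length (meet (f z) (f u))"
    "\<And>x y z. x \<in> R \<Longrightarrow> y \<in> R \<Longrightarrow> z \<in> R \<Longrightarrow> length (meet x y) < length z \<Longrightarrow>
      z ! length (meet x y) = f z ! length (meet (f x) (f y))"
  using assms by (auto simp: strong_similarity_def bij_betw_def)

lemma strong_similarity_length_eq:
  assumes "strong_similarity f R S" "x \<in> R" "y \<in> R" "z \<in> R" "u \<in> R"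
    "length (meet x y) = length (meet z u)"
  shows "length (meet (f x) (f y)) = length (meet (f z) (f u))"
  using strong_similarityD(3)[OF assms(1), of x y z u] strong_similarityD(3)[OF assms(1), of z u x y]
    assms by auto

lemma strong_similarity_comp:
  assumes f: "strong_similarity f R S" and g: "strong_similarity g S T"
  shows "strong_similarity (g \<circ> f) R T"
proof -
  note f = strong_similarityD[OF f] and g = strong_similarityD[OF g]
  have S: "f x \<in> S" if "x \<in> R" for x using that f(2) by blast
  have "inj_on (g \<circ> f) R" using f(1,2) g(1) by (simp add: comp_inj_on)
  then have "strong_similarity (g \<circ> f) R ((g \<circ> f) ` R)"
  proof (rule strong_similarityI)
    fix x y z assume *: "x \<in> R" "y \<in> R" "z \<in> R" "length (meet x y) < length z"
    then have "length (meet (f x) (f y)) < length (f z)" using f(3)[of x y z z] by simp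
    then show "z ! length (meet x y) = (g \<circ> f) z ! length (meet ((g \<circ> f) x) ((g \<circ> f) y))"
      using f(4)[OF *] g(4)[OF S S S] * by simp
  qed (use f(3) g(3) S in simp)
  moreover have "(g \<circ> f) ` R = T" using f(2) g(2) by (simp only: image_comp[symmetric])
  ultimately show ?thesis by simp
qed

lemma strong_similarity_inverse:
  assumes f: "strong_similarity f R S" and T: "T \<subseteq> S"
  shows "strong_similarity (inv_into R f) T (inv_into R f ` T)"
proof (rule strong_similarityI)
  note f = strong_similarityD[OF f]
  have inv: "inv_into R f x \<in> R" "f (inv_into R f x) = x" if "x \<in> T" for x
    using that T f(2) by (auto intro: inv_into_into f_inv_into_f)
  show "inj_on (inv_into R f) T" using T f(2) by (simp add: inj_on_inv_into)
  fix x y z assume *: "x \<in> T" "y \<in> T" "z \<in> T"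
  show "length (meet x y) < length (meet z u) \<longleftrightarrow>
      length (meet (inv_into R f x) (inv_into R f y)) < length (meet (inv_into R f z) (inv_into R f u))"
    if "u \<in> T" for u
    using f(3)[OF inv(1)[OF *(1)] inv(1)[OF *(2)] inv(1)[OF *(3)] inv(1)[OF that]] * that
    by (simp add: inv)
  assume "length (meet x y) < length z"
  then have "length (meet (inv_into R f x) (inv_into R f y)) < length (inv_into R f z)"
    using f(3)[OF inv(1)[OF *(1)] inv(1)[OF *(2)] inv(1)[OF *(3)] inv(1)[OF *(3)]] *
    by (simp add: inv)
  then show "z ! length (meet x y) = inv_into R f z ! length (meet (inv_into R f x) (inv_into R f y))"
    using f(4)[OF inv(1)[OF *(1)] inv(1)[OF *(2)] inv(1)[OF *(3)]] * by (simp add: inv)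
qed

text \<open>Only meaningful when the length of \<open>x\<close> is in the range of \<open>lv\<close>.\<close>

definition collapse :: "(nat \<Rightarrow> nat) \<Rightarrow> nat list \<Rightarrow> nat list" where
  "collapse lv x = map (\<lambda>j. x ! lv j) [0..<inv lv (length x)]"

text \<open>\<open>e\<close> reinserts the digits that \<open>collapse\<close> deleted, copying them
  from some element of \<open>S\<close> compatible with the digits read so far. The choice of this
  element does not matter: elements of \<open>S\<close> split only at levels in the range of
  \<open>lv\<close>, so compatible ones agree up to the next such level.\<close>

lemma envelope:
  assumes d: "0 < d" and S: "S \<subseteq> Tree d" "pairwise (\<parallel>) S"
    and lv: "strict_mono lv" "levels S \<subseteq> range lv"
  obtains e where "e \<in> emb d" "\<And>x. x \<in> S \<Longrightarrow> e (collapse lv x) = x"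
proof -
  \<comment> \<open>The index of the first level at or above \<open>q\<close>, hence the number of
    digits of \<open>y\<close> consumed before position \<open>q\<close>.\<close>
  define ix where "ix q = (LEAST j. q \<le> lv j)" for q
  have ix_lv [simp]: "ix (lv j) = j" for j
    unfolding ix_def using lv(1) by (intro Least_equality) (simp_all add: strict_mono_less_eq)
  have ix_le: "ix q \<le> j \<longleftrightarrow> q \<le> lv j" for q j
  proof
    have "q \<le> lv q" using lv(1) by (rule strict_mono_imp_increasing)
    then have "q \<le> lv (ix q)" unfolding ix_def by (rule LeastI)
    moreover assume "ix q \<le> j"
    ultimately show "q \<le> lv j" using lv(1) by (meson order_trans strict_mono_less_eq)
  qed (simp add: ix_def Least_le)
  define P where "P u q x \<longleftrightarrow> x \<in> S \<and> prefix u (collapse lv x) \<and> q < length x" for u q x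
  \<comment> \<open>The default 0 is used on branches that no element of \<open>S\<close> follows at
    this height.\<close>
  define fill where "fill u q = (if \<exists>x. P u q x then (SOME x. P u q x) ! q else 0)" for u q
  define e where "e y = map (\<lambda>q. if q = lv (ix q) then y ! ix q else fill (take (ix q) y) q)
    [0..<lv (length y)]" for y
  have fill: "fill u q < d" for u q
  proof (cases "\<exists>x. P u q x")
    case True
    define x where "x = (SOME x. P u q x)"
    have "P u q x" unfolding x_def using True by (rule someI_ex)
    then have "x ! q < d" using S(1) unfolding P_def by (blast intro: nth_Tree)
    then show ?thesis using True by (simp add: fill_def x_def)
  qed (simp add: fill_def d)
  have ix_less: "ix q < length y" if "q < lv (length y)" "q = lv (ix q)" for q and y :: "nat list"
    using that lv(1) by (metis strict_mono_less)
  have "strong_emb d lv e"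
    unfolding strong_emb_def
  proof safe
    fix y a assume y: "y \<in> Tree d"
    have "y ! ix q < d" if "q < lv (length y)" "q = lv (ix q)" for q
      using y ix_less[OF that] by (rule nth_Tree)
    then show "e y \<in> Tree d" using fill by (auto simp: e_def Tree_def)
    show "length (e y) = lv (length y)" by (simp add: e_def)
    have "lv (length y) < lv (Suc (length y))" using lv(1) by (simp add: strict_mono_less)
    \<comment> \<open>Position \<open>lv (length y)\<close> is where the new digit \<open>a\<close>
      is written; earlier positions do not see it.\<close>
    then have *: "[0..<lv (Suc (length y))] =
        [0..<lv (length y)] @ lv (length y) # [Suc (lv (length y))..<lv (Suc (length y))]"
      using upt_add_eq_append[of 0 "lv (length y)" "lv (Suc (length y)) - lv (length y)"]
        upt_conv_Cons[of "lv (length y)" "lv (Suc (length y))"] by simp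
    have "map (\<lambda>q. if q = lv (ix q) then (y @ [a]) ! ix q else fill (take (ix q) (y @ [a])) q)
        [0..<lv (length y)] = e y"
      using ix_less ix_le by (auto simp: e_def nth_append)
    then show "prefix (e y @ [a]) (e (y @ [a]))"
      by (simp add: e_def[of "y @ [a]"] * )
  qed
  moreover have "e (collapse lv x) = x" if x: "x \<in> S" for x
  proof -
    have "length (meet x x) \<in> levels S" using x unfolding levels_def by blast
    then obtain j where j: "length x = lv j" using lv(2) by auto
    have inv: "inv lv (lv i) = i" for i
      using lv(1) by (simp add: strict_mono_imp_inj_on)
    have len: "length (collapse lv x) = j" by (simp add: collapse_def j inv)
    have nth: "(if q = lv (ix q) then collapse lv x ! ix q else fill (take (ix q) (collapse lv x)) q) = x ! q"
      if q: "q < lv j" for q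
    proof (cases "q = lv (ix q)")
      case True
      then have "ix q < j" using q lv(1) by (metis strict_mono_less)
      with True show ?thesis by (simp add: collapse_def j inv)
    next
      case False
      define u where "u = take (ix q) (collapse lv x)"
      have "P u q x" using x q by (simp add: P_def u_def take_is_prefix j)
      define x' where "x' = (SOME x. P u q x)"
      have x': "P u q x'" unfolding x'_def using \<open>P u q x\<close> by (rule someI)
      then have fill_eq: "fill u q = x' ! q" by (auto simp: fill_def x'_def)
      have "x' ! q = x ! q"
      proof (cases "x = x'")
        case False
        then have par: "x \<parallel> x'" using S(2) x x' by (auto simp: P_def pairwise_def)
        have "length (meet x x') \<in> levels S" using x x' unfolding levels_def P_def by blast
        then obtain r where r: "length (meet x x') = lv r" using lv(2) by auto
        \<comment> \<open>A split at a level \<open>lv r\<close> below \<open>q\<close> would have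
          been seen in \<open>u\<close>: both collapses extend \<open>u\<close>, which includes
          digit \<open>r\<close>.\<close>
        have "q < lv r"
        proof (rule ccontr)
          assume "\<not> q < lv r"
          moreover have "q \<noteq> lv r" using \<open>q \<noteq> lv (ix q)\<close> by auto
          ultimately have "\<not> ix q \<le> r" by (simp add: ix_le)
          then have rq: "r < ix q" by simp
          have "ix q \<le> j" using q by (simp add: ix_le)
          then have lu: "length u = ix q" by (simp add: u_def len)
          from x' have "prefix u (collapse lv x')" by (simp add: P_def)
          then have "u ! r = collapse lv x' ! r" "r < length (collapse lv x')"
            using rq lu by (auto simp: prefix_def nth_append)
          moreover have "u ! r = collapse lv x ! r" using rq by (simp add: u_def)
          moreover have "r < length (collapse lv x)" using rq \<open>ix q \<le> j\<close> len by simp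
          ultimately have "x ! lv r = x' ! lv r" by (simp add: collapse_def)
          then show False using length_meet_less(3)[OF par] r by simp
        qed
        then show ?thesis using nth_less_meet[of q x x'] r by simp
      qed simp
      with False fill_eq show ?thesis by (simp add: u_def)
    qed
    show ?thesis
    proof (rule nth_equalityI)
      show "length (e (collapse lv x)) = length x" by (simp add: e_def len j)
      fix q assume "q < length (e (collapse lv x))"
      then show "e (collapse lv x) ! q = x ! q" using nth[of q] by (auto simp: e_def len split: if_splits)
    qed
  qed
  ultimately show thesis by (intro that) (auto simp: emb_def)
qed

lemma collapse_in_Tree:
  assumes "x \<in> Tree d" "strict_mono lv" "length x \<in> range lv"
  shows "collapse lv x \<in> Tree d"
proof -
  from assms(3) obtain j where j: "length x = lv j" by auto
  have "x ! lv i < d" if "i < j" for i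
    using that j assms(1,2) by (intro nth_Tree) (simp_all add: strict_mono_less)
  then show ?thesis
    using assms(2) by (auto simp: collapse_def Tree_def j strict_mono_imp_inj_on)
qed

section \<open>Collapsing all copies to a common set\<close>

lemma finite_levels: "finite F \<Longrightarrow> finite (levels F)"
proof -
  assume "finite F"
  then have "finite ((\<lambda>(x, y). length (meet x y)) ` (F \<times> F))" by simp
  moreover have "levels F = (\<lambda>(x, y). length (meet x y)) ` (F \<times> F)" by (auto simp: levels_def)
  ultimately show ?thesis by simp
qed

text \<open>\<open>lv\<close> runs through the finite set \<open>L\<close> first and then continues,
  because a strong embedding has infinitely many levels. The last clause makes \<open>L\<close> an
  initial segment of its range.\<close>

definition enumerates :: "(nat \<Rightarrow> nat) \<Rightarrow> nat set \<Rightarrow> bool" where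
  "enumerates lv L \<longleftrightarrow>
     strict_mono lv \<and> L \<subseteq> range lv \<and> (\<forall>i. lv i \<notin> L \<longrightarrow> (\<forall>q\<in>L. q < lv i))"

lemma enumerates_exists:
  assumes "finite L"
  shows "\<exists>lv. enumerates lv L"
proof -
  obtain M where M: "\<And>q. q \<in> L \<Longrightarrow> q < M"
    using assms by (auto simp: finite_nat_set_iff_bounded)
  define X where "X = L \<union> {M..}"
  have X: "infinite X" by (simp add: X_def infinite_Ici)
  have "strict_mono (enumerate X)" using X by (rule strict_mono_enumerate)
  moreover have "L \<subseteq> range (enumerate X)" using range_enumerate[OF X] by (auto simp: X_def)
  moreover have "q < enumerate X i" if "enumerate X i \<notin> L" "q \<in> L" for i q
    using that M[of q] enumerate_in_set[OF X, of i] by (auto simp: X_def)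
  ultimately show ?thesis unfolding enumerates_def by blast
qed

text \<open>A strong similarity maps the levels of \<open>F\<close> to those of \<open>S\<close> in
  increasing order and preserves the digits found there. Reading only these digits gives the same
  sequence before and after.\<close>

lemma collapse_similar:
  assumes f: "strong_similarity f F S" and "finite F" and "enumerates lv (levels F)"
  obtains lv' :: "nat \<Rightarrow> nat" where "strict_mono lv'" "levels S \<subseteq> range lv'"
    "\<And>x. x \<in> F \<Longrightarrow> collapse lv' (f x) = collapse lv x"
proof -
  have lv: "strict_mono lv" "levels F \<subseteq> range lv"
    "\<And>i q. lv i \<notin> levels F \<Longrightarrow> q \<in> levels F \<Longrightarrow> q < lv i"
    using assms(3) by (auto simp: enumerates_def)
  note fD = strong_similarityD[OF f]
  \<comment> \<open>The induced map on levels; by \<open>strong_similarity_length_eq\<close> it does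
    not depend on the chosen pair.\<close>
  define h where "h q = (SOME v. \<exists>x\<in>F. \<exists>y\<in>F. length (meet x y) = q \<and> v = length (meet (f x) (f y)))" for q
  have h: "h (length (meet x y)) = length (meet (f x) (f y))" if "x \<in> F" "y \<in> F" for x y
    unfolding h_def
  proof (rule some_equality)
    fix v assume "\<exists>x'\<in>F. \<exists>y'\<in>F. length (meet x' y') = length (meet x y) \<and> v = length (meet (f x') (f y'))"
    then show "v = length (meet (f x) (f y))"
      using strong_similarity_length_eq[OF f] that by blast
  qed (use that in blast)
  have h_mono: "h q < h q'" if "q \<in> levels F" "q' \<in> levels F" "q < q'" for q q'
    using that h fD(3) by (auto simp: levels_def)
  obtain N where N: "\<And>q. q \<in> levels F \<Longrightarrow> h q < N"
    using finite_imageI[OF finite_levels[OF \<open>finite F\<close>], of h] by (auto simp: finite_nat_set_iff_bounded)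
  \<comment> \<open>Beyond the levels of \<open>F\<close>, the offset \<open>N\<close> keeps the
    enumeration above all values of \<open>h\<close>.\<close>
  define lv' where "lv' i = (if lv i \<in> levels F then h (lv i) else N + i)" for i
  have mono: "strict_mono lv'"
  proof (rule strict_monoI)
    fix i j :: nat assume "i < j"
    then have "lv i < lv j" using lv(1) by (simp add: strict_mono_less)
    then show "lv' i < lv' j"
      using h_mono[of "lv i" "lv j"] N[of "lv i"] lv(3)[of i "lv j"] \<open>i < j\<close> by (auto simp: lv'_def)
  qed
  have lv': "\<exists>i. lv i = length (meet x y) \<and> lv' i = length (meet (f x) (f y))" if "x \<in> F" "y \<in> F" for x y
  proof -
    have "length (meet x y) \<in> levels F" using that unfolding levels_def by blast
    then obtain i where "lv i = length (meet x y)" using lv(2) by auto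
    with \<open>length (meet x y) \<in> levels F\<close> show ?thesis using h[OF that] by (auto simp: lv'_def)
  qed
  show thesis
  proof (rule that[OF mono])
    show "levels S \<subseteq> range lv'"
    proof
      fix q assume "q \<in> levels S"
      then obtain x y where "x \<in> F" "y \<in> F" "q = length (meet (f x) (f y))"
        using fD(2) by (auto simp: levels_def)
      then show "q \<in> range lv'" using lv'[of x y] by (metis rangeI)
    qed
    fix x assume x: "x \<in> F"
    obtain j where j: "lv j = length x" "lv' j = length (f x)" using lv'[OF x x] by auto
    have "inv lv (length x) = j" "inv lv' (length (f x)) = j"
      using lv(1) mono by (simp_all add: strict_mono_imp_inj_on flip: j)
    moreover have "f x ! lv' i = x ! lv i" if "i < j" for i
    proof -
      have lt: "lv i < length x" using that lv(1) by (simp add: strict_mono_less flip: j)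
      have "length (meet x x) \<in> levels F" using x unfolding levels_def by blast
      \<comment> \<open>\<open>length x\<close> is itself a level of \<open>F\<close>, and these
        form an initial segment of the range of \<open>lv\<close>.\<close>
      then have "lv i \<in> levels F" using lv(3)[of i "length x"] lt by fastforce
      then obtain y z where yz: "y \<in> F" "z \<in> F" "lv i = length (meet y z)"
        by (auto simp: levels_def)
      then have "lv' i = length (meet (f y) (f z))" using h \<open>lv i \<in> levels F\<close> by (simp add: lv'_def)
      then show ?thesis using fD(4)[OF yz(1,2) x] lt yz(3) by simp
    qed
    ultimately show "collapse lv' (f x) = collapse lv x" by (simp add: collapse_def)
  qed
qed

subsection \<open>Strong diagonalizations\<close>

text \<open>
  Strong diagonality without the bound on immediate successors: condition (ii) already allows only
  the digits 0 and 1 after a meet.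
\<close>

definition diagonal :: "nat list set \<Rightarrow> bool" where
  "diagonal S \<longleftrightarrow> pairwise (\<parallel>) S \<and> inj_on length (meet_closure S) \<and>
     (\<forall>x\<in>S. \<forall>y\<in>S. \<forall>z\<in>S. x \<noteq> y \<longrightarrow>
        (length (meet x y) < length z \<and> \<not> prefix (meet x y) z \<longrightarrow> z ! length (meet x y) = 0) \<and>
        x ! length (meet x y) \<in> {0, 1})"

lemma strongly_diagonal_imp_diagonal: "strongly_diagonal d S \<Longrightarrow> diagonal S"
  by (auto simp: strongly_diagonal_def diagonal_def)

lemma diagonalD:
  assumes "diagonal S" "x \<in> S" "y \<in> S"
  shows "x \<noteq> y \<Longrightarrow> x \<parallel> y"
    "z \<in> S \<Longrightarrow> x \<noteq> y \<Longrightarrow> length (meet x y) < length z \<Longrightarrow> \<not> prefix (meet x y) z \<Longrightarrow>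
       z ! length (meet x y) = 0"
    "x \<noteq> y \<Longrightarrow> x ! length (meet x y) \<in> {0, 1}"
    "x \<noteq> y \<Longrightarrow> y ! length (meet x y) \<in> {0, 1}"
    "z \<in> S \<Longrightarrow> u \<in> S \<Longrightarrow> length (meet x y) = length (meet z u) \<Longrightarrow> meet x y = meet z u"
proof -
  note S = assms(1)[unfolded diagonal_def]
  show "x \<noteq> y \<Longrightarrow> x \<parallel> y" using S assms(2,3) by (auto simp: pairwise_def)
  show "z \<in> S \<Longrightarrow> x \<noteq> y \<Longrightarrow> length (meet x y) < length z \<Longrightarrow> \<not> prefix (meet x y) z \<Longrightarrow>
       z ! length (meet x y) = 0"
    "x \<noteq> y \<Longrightarrow> x ! length (meet x y) \<in> {0, 1}"
    using S assms(2,3) by blast+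
  have "v ! length (meet v w) \<in> {0, 1}" if "v \<in> S" "w \<in> S" "v \<noteq> w" for v w
    using S that by blast
  from this[OF assms(3,2)] show "x \<noteq> y \<Longrightarrow> y ! length (meet x y) \<in> {0, 1}"
    by (auto simp: meet_commute[of y x])
  show "z \<in> S \<Longrightarrow> u \<in> S \<Longrightarrow> length (meet x y) = length (meet z u) \<Longrightarrow> meet x y = meet z u"
    using S assms(2,3) unfolding inj_on_def meet_closure_def by blast
qed

lemma strong_emb_similarity:
  assumes f: "strong_emb d l f" and d: "0 < d" and R: "R \<subseteq> Tree d"
  shows "strong_similarity f R (f ` R)"
proof (rule strong_similarityI)
  show "inj_on f R" using strong_emb_inj[OF f d] R by (rule inj_on_subset)
  have len: "length (meet (f x) (f y)) = l (length (meet x y))" if "x \<in> R" "y \<in> R" for x y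
    using that R by (metis strong_emb_meet[OF f] strong_embD(2)[OF f] meet_in_Tree subsetD)
  show "length (meet x y) < length (meet z u) \<longleftrightarrow> length (meet (f x) (f y)) < length (meet (f z) (f u))"
    if "x \<in> R" "y \<in> R" "z \<in> R" "u \<in> R" for x y z u
    using that strong_emb_strict_mono[OF f d] by (simp add: len strict_mono_less)
  show "z ! length (meet x y) = f z ! length (meet (f x) (f y))"
    if "x \<in> R" "y \<in> R" "z \<in> R" "length (meet x y) < length z" for x y z
    using that R strong_emb_nth[OF f, of z] by (auto simp: len)
qed

text \<open>Diagonality speaks only of prefixes, lengths and digits at meets, which strong
  similarities preserve. This lets the diagonalization be applied to the image of a diagonal set
  under a strong embedding.\<close>

lemma diagonal_similar:
  assumes f: "strong_similarity f R S" and R: "diagonal R"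
  shows "diagonal S"
proof -
  note fD = strong_similarityD[OF f]
  have S: "S = f ` R" using fD(2) by simp
  have prefix: "prefix (meet x y) (meet z u) \<longleftrightarrow> prefix (meet (f x) (f y)) (meet (f z) (f u))"
    if "x \<in> R" "y \<in> R" "z \<in> R" "u \<in> R" for x y z u
    using f that by (auto simp: strong_similarity_def)
  have par: "pairwise (\<parallel>) S"
    unfolding S pairwise_def
  proof clarify
    fix x y assume *: "x \<in> R" "y \<in> R" "f x \<noteq> f y"
    then have "x \<parallel> y" using diagonalD(1)[OF R] by blast
    then show "f x \<parallel> f y" using prefix[of x x y y] prefix[of y y x x] * by auto
  qed
  have inj: "inj_on length (meet_closure S)"
  proof (rule inj_onI)
    fix v w assume "v \<in> meet_closure S" "w \<in> meet_closure S" and eq: "length v = length w"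
    then obtain x y z u where R4: "x \<in> R" "y \<in> R" "z \<in> R" "u \<in> R"
      and vw: "v = meet (f x) (f y)" "w = meet (f z) (f u)"
      by (auto simp: meet_closure_def S)
    have "length (meet x y) = length (meet z u)"
      using fD(3)[of x y z u] fD(3)[of z u x y] R4 eq vw by auto
    then have "meet x y = meet z u" using diagonalD(5)[OF R] R4 by blast
    then show "v = w"
      using prefix[of x y z u] prefix[of z u x y] R4 vw by (auto intro: prefix_order.antisym)
  qed
  have digits: "(length (meet (f x) (f y)) < length (f z) \<and> \<not> prefix (meet (f x) (f y)) (f z) \<longrightarrow>
      f z ! length (meet (f x) (f y)) = 0) \<and> f x ! length (meet (f x) (f y)) \<in> {0, 1}"
    if R3: "x \<in> R" "y \<in> R" "z \<in> R" and "f x \<noteq> f y" for x y z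
  proof -
    have ne: "x \<noteq> y" using that by blast
    have "length (meet x y) < length x" using diagonalD(1)[OF R] R3 ne length_meet_less(1) by blast
    then have "f x ! length (meet (f x) (f y)) \<in> {0, 1}"
      using fD(4)[of x y x] R3 diagonalD(3)[OF R R3(1,2) ne] by simp
    moreover have "f z ! length (meet (f x) (f y)) = 0"
      if "length (meet (f x) (f y)) < length (f z)" "\<not> prefix (meet (f x) (f y)) (f z)"
    proof -
      have "length (meet x y) < length z" "\<not> prefix (meet x y) z"
        using fD(3)[of x y z z] prefix[of x y z z] R3 that by simp_all
      then show ?thesis using fD(4)[of x y z] R3 diagonalD(2)[OF R R3 ne] by simp
    qed
    ultimately show ?thesis by blast
  qed
  show ?thesis
    unfolding diagonal_def
  proof (intro conjI[OF par] conjI[OF inj] ballI impI)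
    fix x y z assume "x \<in> S" "y \<in> S" "z \<in> S" and ne: "x \<noteq> y"
    then obtain x' y' z' where "x' \<in> R" "y' \<in> R" "z' \<in> R" "x = f x'" "y = f y'" "z = f z'"
      unfolding S by (elim imageE)
    then show "(length (meet x y) < length z \<and> \<not> prefix (meet x y) z \<longrightarrow> z ! length (meet x y) = 0) \<and>
        x ! length (meet x y) \<in> {0, 1}"
      using digits[of x' y' z'] ne by simp
  qed
qed

text \<open>A diagonalization preserves strict comparisons of meet lengths; in a diagonal set equal
  lengths mean equal meets, which reduces ties to pairs splitting at one node. The digits follow
  from the passing clause, from the forced digit 0 away from a meet, and from \<open>\<prec>\<close>
  at the meet.\<close>

lemma diagonalization_similarity:
  assumes f: "strong_diagonalization d f" and R: "R \<subseteq> Tree d" "diagonal R"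
  shows "strong_similarity f R (f ` R)"
proof -
  have RT: "x \<in> Tree d" if "x \<in> R" for x using that R(1) by blast
  have inj: "inj_on f R"
    using f R(1) unfolding strong_diagonalization_def by (meson inj_on_subset)
  have image: "diagonal (f ` Tree d)"
    using f unfolding strong_diagonalization_def by (blast intro: strongly_diagonal_imp_diagonal)
  have fT: "f x \<in> f ` Tree d" if "x \<in> R" for x using RT[OF that] by simp
  have mono: "length (meet (f x) (f y)) < length (meet (f z) (f u))"
    if "x \<in> R" "y \<in> R" "z \<in> R" "u \<in> R" "length (meet x y) < length (meet z u)" for x y z u
    using f RT that unfolding strong_diagonalization_def by blast
  have pass: "z ! length x = f z ! length (f x)" if "x \<in> R" "z \<in> R" "length x < length z" for x z
    using f RT that unfolding strong_diagonalization_def by blast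
  have left: "f x \<prec> f y" if "x \<in> R" "y \<in> R" "x \<prec> y" for x y
    using f RT that unfolding strong_diagonalization_def by blast
  have le: "length (meet (f x) (f y)) \<le> length (meet (f z) (f u))"
    if R4: "x \<in> R" "y \<in> R" "z \<in> R" "u \<in> R" and eq: "length (meet x y) = length (meet z u)" for x y z u
  proof -
    have m: "meet x y = meet z u" using diagonalD(5)[OF R(2)] R4 eq by blast
    show ?thesis
    proof (cases "x = y \<or> z = u")
      case True
      \<comment> \<open>In an antichain, a meet that is itself an element comes only from that
        element with itself.\<close>
      have "x = y \<and> z = u \<and> x = u"
      proof (cases "x = y")
        case True
        then have "prefix x z" "prefix x u"
          using m by (metis longest_common_prefix_prefix1 longest_common_prefix_prefix2 meet_self)+
        then show ?thesis using diagonalD(1)[OF R(2)] R4 True by blast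
      next
        case False
        with True m have "z = u" "prefix z x" "prefix z y"
          by (metis longest_common_prefix_prefix1 longest_common_prefix_prefix2 meet_self)+
        then show ?thesis using diagonalD(1)[OF R(2)] R4 False by blast
      qed
      then show ?thesis by auto
    next
      case False
      define n where "n = length (meet x y)"
      have zu: "n = length (meet z u)" using eq n_def by simp
      have xy: "x \<parallel> y" "z \<parallel> u" using diagonalD(1)[OF R(2)] R4 False by blast+
      have n_less: "n < length x" "n < length y" "n < length z" "n < length u"
        using length_meet_less[OF xy(1)] length_meet_less[OF xy(2)] n_def zu by simp_all
      have ne: "x ! n \<noteq> y ! n" "z ! n \<noteq> u ! n"
        using length_meet_less(3)[OF xy(1)] length_meet_less(3)[OF xy(2)] n_def zu by simp_all
      have "x ! n \<in> {0, 1}" "y ! n \<in> {0, 1}" "z ! n \<in> {0, 1}" "u ! n \<in> {0, 1}"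
        using diagonalD(3,4)[OF R(2) R4(1,2)] diagonalD(3,4)[OF R(2) R4(3,4)] False n_def zu by auto
      then have cases: "x ! n = z ! n \<and> y ! n = u ! n \<or> x ! n = u ! n \<and> y ! n = z ! n"
        using ne by auto
      have pre: "prefix (meet x y) x" "prefix (meet x y) y" "prefix (meet x y) z" "prefix (meet x y) u"
        unfolding m by (metis m longest_common_prefix_prefix1 longest_common_prefix_prefix2)+
      have "length (meet x y) \<le> length (meet v w)"
        if "prefix (meet x y) v" "prefix (meet x y) w" for v w
        using that by (simp add: longest_common_prefix_max_prefix prefix_length_le)
      then have n_le: "n \<le> length (meet x z)" "n \<le> length (meet y u)" "n \<le> length (meet x u)"
        "n \<le> length (meet y z)"
        using pre by (simp_all add: n_def)
      \<comment> \<open>If \<open>z'\<close> stays with \<open>x\<close> and \<open>u'\<close> with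
        \<open>y\<close> beyond the common meet, so do their images. A longer meet of
        \<open>f x\<close> and \<open>f y\<close> would then make that of \<open>f z\<close> and
        \<open>f u\<close> longer than it is.\<close>
      have *: "length (meet (f x) (f y)) \<le> length (meet (f z) (f u))"
        if zu': "{z', u'} = {z, u}" and "n < length (meet x z')" "n < length (meet y u')" for z' u'
      proof (rule ccontr)
        assume "\<not> ?thesis"
        then have less: "length (meet (f z) (f u)) < length (meet (f x) (f y))" by simp
        define k where "k = length (meet (f z) (f u))"
        have R': "z' \<in> R" "u' \<in> R" using zu' R4 by (auto simp: doubleton_eq_iff)
        have "k < length (meet (f x) (f z'))" "k < length (meet (f y) (f u'))"
          unfolding k_def using that zu R4 R' by (auto intro!: mono)
        then have "k < length (meet (f z') (f u'))"
          using less meet_ultrametric[of k "f z'" "f x" "f y"] meet_ultrametric[of k "f z'" "f y" "f u'"]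
          by (simp add: k_def meet_commute[of "f z'" "f x"])
        moreover have "length (meet (f z') (f u')) = k"
          using zu' meet_commute[of "f u" "f z"] by (auto simp: k_def doubleton_eq_iff)
        ultimately show False by simp
      qed
      from cases show ?thesis
      proof
        assume "x ! n = z ! n \<and> y ! n = u ! n"
        then show ?thesis using n_le n_less by (intro *[of z u] less_meet_if_nth_eq) auto
      next
        assume "x ! n = u ! n \<and> y ! n = z ! n"
        then show ?thesis using n_le n_less by (intro *[of u z] less_meet_if_nth_eq) auto
      qed
    qed
  qed
  have len: "length (meet x y) < length (meet z u) \<longleftrightarrow> length (meet (f x) (f y)) < length (meet (f z) (f u))"
    if "x \<in> R" "y \<in> R" "z \<in> R" "u \<in> R" for x y z u
  proof
    assume "length (meet (f x) (f y)) < length (meet (f z) (f u))"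
    then show "length (meet x y) < length (meet z u)"
      using mono[of z u x y] le[of z u x y] that by (metis leD linorder_cases order_less_asym)
  qed (use mono that in blast)
  \<comment> \<open>On both sides the two digits at the meet are 0 and 1, and \<open>\<prec>\<close>
    determines which of the two sequences has 0.\<close>
  have nth: "x ! length (meet x y) = f x ! length (meet (f x) (f y))"
    if xy: "x \<in> R" "y \<in> R" "x \<noteq> y" for x y
  proof -
    have "f x \<noteq> f y" using inj xy by (auto dest: inj_onD)
    note 1 = diagonalD(3,4)[OF image fT[OF xy(1)] fT[OF xy(2)] this]
    note 2 = diagonalD(3,4)[OF R(2) xy]
    have par: "x \<parallel> y" using diagonalD(1)[OF R(2)] xy by blast
    show ?thesis
    proof (cases "x ! length (meet x y) < y ! length (meet x y)")
      case True
      then have "x \<prec> y" using par by (simp add: left_of_def)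
      from left[OF xy(1,2) this] show ?thesis using True 1 2 by (auto simp: left_of_def)
    next
      case False
      then have "y ! length (meet x y) < x ! length (meet x y)" using length_meet_less(3)[OF par] by simp
      moreover from this have "y \<prec> x"
        using par by (simp add: left_of_def meet_commute[of y x] parallel_commute)
      from left[OF xy(2,1) this] have
        "f y ! length (meet (f x) (f y)) < f x ! length (meet (f x) (f y))"
        by (simp add: left_of_def meet_commute[of "f y"])
      ultimately show ?thesis using 1 2 by auto
    qed
  qed
  show ?thesis
  proof (rule strong_similarityI[OF inj len])
    fix x y z assume R3: "x \<in> R" "y \<in> R" "z \<in> R" and lz: "length (meet x y) < length z"
    define n where "n = length (meet x y)"
    define n' where "n' = length (meet (f x) (f y))"
    have lfz: "n' < length (f z)" using mono[OF R3 R3(3)] lz by (simp add: n'_def)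
    show "z ! length (meet x y) = f z ! length (meet (f x) (f y))"
    proof (cases "x = y")
      case True
      then show ?thesis using pass[OF R3(1) R3(3)] lz by simp
    next
      case False
      then have fne: "f x \<noteq> f y" using inj R3 by (auto dest: inj_onD)
      show ?thesis
      proof (cases "prefix (meet x y) z")
        case False
        \<comment> \<open>\<open>z\<close> leaves \<open>x\<close> before the meet with
          \<open>y\<close>, and \<open>f z\<close> does likewise, so both digits are 0.\<close>
        then have "length (meet x z) < length (meet x y)" by (simp add: prefix_meet_iff)
        then have "length (meet (f x) (f z)) < length (meet (f x) (f y))" using mono R3 by blast
        then have "\<not> prefix (meet (f x) (f y)) (f z)" by (simp add: prefix_meet_iff)
        then show ?thesis
          using diagonalD(2)[OF R(2) R3 \<open>x \<noteq> y\<close> lz False]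
            diagonalD(2)[OF image fT[OF R3(1)] fT[OF R3(2)] fT[OF R3(3)] fne] lfz
          by (simp add: n'_def)
      next
        case True
        \<comment> \<open>\<open>z\<close> follows \<open>x\<close> or \<open>y\<close> past level
          \<open>n\<close>, and the images do the same; the digit is read off from this companion
          \<open>w\<close>.\<close>
        have branch: "z ! n = f z ! n'" if w: "w \<in> R" "n < length (meet z w)" "w ! n = f w ! n'" for w
        proof -
          have "n' < length (meet (f z) (f w))"
            using mono[OF R3(1,2,3) w(1)] w(2) by (simp add: n_def n'_def)
          then show ?thesis using nth_less_meet w by metis
        qed
        have par: "x \<parallel> y" using diagonalD(1)[OF R(2)] R3 \<open>x \<noteq> y\<close> by blast
        have "prefix (meet y x) z" using True by (simp add: meet_commute[of y x])
        then have "length (meet y x) \<le> length (meet y z)" "length (meet x y) \<le> length (meet x z)"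
          using True by (simp_all add: prefix_meet_iff)
        then have n_le: "n \<le> length (meet z y)" "n \<le> length (meet z x)"
          by (simp_all add: n_def meet_commute[of z] meet_commute[of y x])
        have nth_y: "y ! n = f y ! n'"
          using nth[OF R3(2,1)] \<open>x \<noteq> y\<close> by (simp add: n_def n'_def meet_commute[of _ x] meet_commute[of _ "f x"])
        show ?thesis
        proof (cases "n < length (meet z x)")
          case True
          then show ?thesis
            using branch[OF R3(1)] nth[OF R3(1,2) \<open>x \<noteq> y\<close>] by (simp add: n_def n'_def)
        next
          case False
          then have "length (meet z x) = n" using n_le by simp
          moreover from this have "z \<noteq> x" using length_meet_less(1)[OF par] by (auto simp: n_def)
          \<comment> \<open>\<open>z\<close> splits from \<open>x\<close> exactly at
            \<open>n\<close>, where only 0 and 1 occur, so it must take the digit of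
            \<open>y\<close>.\<close>
          ultimately have "z ! n \<in> {0, 1}" "z ! n \<noteq> x ! n"
            using diagonalD(3)[OF R(2) R3(3,1)] length_meet_less(3)[OF diagonalD(1)[OF R(2) R3(3,1)]]
            by auto
          moreover have "x ! n \<noteq> y ! n" "x ! n \<in> {0, 1}" "y ! n \<in> {0, 1}"
            using diagonalD(3,4)[OF R(2) R3(1,2) \<open>x \<noteq> y\<close>] length_meet_less(3)[OF par]
            by (simp_all add: n_def)
          ultimately have "z ! n = y ! n" by auto
          then have "n < length (meet z y)"
            using n_le lz length_meet_less(2)[OF par] by (intro less_meet_if_nth_eq) (auto simp: n_def)
          then show ?thesis using branch[OF R3(2)] nth_y by (simp add: n_def n'_def)
        qed
      qed
    qed
  qed
qed

section \<open>Homogeneous copies of the diagonal set\<close>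

theorem theorem4p2:
  fixes d p :: nat
    and \<Delta> :: "nat list \<Rightarrow> nat list"
    and F :: "nat \<Rightarrow> nat list set"
    and m :: "nat \<Rightarrow> nat"
    and \<gamma> :: "nat \<Rightarrow> nat list set \<Rightarrow> nat"
  assumes "d \<ge> 2"
    and "strong_diagonalization d \<Delta>"
    and "\<And>i. i < p \<Longrightarrow> finite (F i) \<and> F i \<subseteq> \<Delta> ` Tree d"
    and "\<And>i j. i < p \<Longrightarrow> j < p \<Longrightarrow> i \<noteq> j \<Longrightarrow> \<not> strongly_similar (F i) (F j)"
    and "\<And>i. i < p \<Longrightarrow> \<gamma> i \<in> Sims (\<Delta> ` Tree d) (F i) \<rightarrow> {..<m i}"
  shows "\<exists>g D. D \<subseteq> \<Delta> ` Tree d \<and> strong_similarity g (\<Delta> ` Tree d) D \<and>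
           (\<forall>i<p. \<exists>c. \<forall>S \<in> Sims D (F i). \<gamma> i S = c)"
proof -
  have d: "0 < d" using assms(1) by simp
  define DD where "DD = \<Delta> ` Tree d"
  have DD: "DD \<subseteq> Tree d" "diagonal DD"
    using assms(2) by (auto simp: DD_def strong_diagonalization_def intro: strongly_diagonal_imp_diagonal)
  have "\<forall>i. \<exists>lv. i < p \<longrightarrow> enumerates lv (levels (F i))"
    using enumerates_exists[OF finite_levels] assms(3) by blast
  from choice[OF this] obtain lv where lv: "\<And>i. i < p \<Longrightarrow> enumerates (lv i) (levels (F i))" by blast
  define Q where "Q i = collapse (lv i) ` F i" for i
  have QT: "Q i \<subseteq> Tree d" if i: "i < p" for i
  proof -
    have "collapse (lv i) x \<in> Tree d" if x: "x \<in> F i" for x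
    proof (rule collapse_in_Tree)
      show "x \<in> Tree d" using assms(3)[OF i] x DD(1) by (auto simp: DD_def)
      have "length (meet x x) \<in> levels (F i)" using x unfolding levels_def by blast
      then show "length x \<in> range (lv i)" using lv[OF i] by (auto simp: enumerates_def)
    qed (use lv[OF i] in \<open>simp add: enumerates_def\<close>)
    then show ?thesis by (auto simp: Q_def)
  qed
  \<comment> \<open>All copies of \<open>F i\<close> collapse to the same \<open>Q i\<close>, and
    the envelope of a copy recovers it from \<open>Q i\<close>.\<close>
  have copy: "\<exists>e\<in>emb d. e ` Q i = S" if i: "i < p" and S: "S \<in> Sims DD (F i)" for i S
  proof -
    from S obtain f where f: "strong_similarity f (F i) S" and SD: "S \<subseteq> DD"
      by (auto simp: Sims_def strongly_similar_def)
    obtain lv' :: "nat \<Rightarrow> nat" where lv': "strict_mono lv'" "levels S \<subseteq> range lv'"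
      "\<And>x. x \<in> F i \<Longrightarrow> collapse lv' (f x) = collapse (lv i) x"
      using collapse_similar[OF f _ lv[OF i]] assms(3)[OF i] by blast
    have "pairwise (\<parallel>) S" using DD(2) SD unfolding diagonal_def by (blast intro: pairwise_subset)
    then obtain e where e: "e \<in> emb d" "\<And>x. x \<in> S \<Longrightarrow> e (collapse lv' x) = x"
      using envelope[OF d _ _ lv'(1,2)] SD DD(1) by blast
    have fS: "f ` F i = S" using strong_similarityD(2)[OF f] .
    have "e ` Q i = (\<lambda>x. e (collapse lv' (f x))) ` F i"
      using lv'(3) by (simp add: Q_def image_image)
    also have "\<dots> = f ` F i" using e(2) fS by (intro image_cong) auto
    finally show ?thesis using e(1) fS by blast
  qed
  \<comment> \<open>All colourings are handled at once. The cap \<open>m i\<close> bounds the value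
    also where the image of \<open>Q i\<close> is no copy of \<open>F i\<close>; on copies it
    changes nothing.\<close>
  define c where "c e = map (\<lambda>i. min (\<gamma> i (\<Delta> ` e ` Q i)) (m i)) [0..<p]" for e
  have "range c \<subseteq> {xs. set xs \<subseteq> {..(\<Sum>i<p. m i)} \<and> length xs = p}"
  proof -
    have "min k (m i) \<le> (\<Sum>i<p. m i)" if "i < p" for i k
      using that by (intro min.coboundedI2 member_le_sum) auto
    then show ?thesis by (auto simp: c_def)
  qed
  then have fin: "finite (range c)"
    by (rule finite_subset) (simp add: finite_lists_length_eq)
  \<comment> \<open>The colour of \<open>e\<close> depends only on its values on the finite sets
    \<open>Q i\<close>, hence on finitely many levels.\<close>
  obtain K where K: "\<And>i x. i < p \<Longrightarrow> x \<in> Q i \<Longrightarrow> length x < K"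
  proof -
    have "finite (\<Union>i<p. length ` Q i)" using assms(3) by (auto simp: Q_def)
    then obtain K where "\<forall>n\<in>(\<Union>i<p. length ` Q i). n < K"
      unfolding finite_nat_set_iff_bounded by blast
    then show thesis by (intro that[of K]) auto
  qed
  have "\<exists>\<phi>\<in>emb d. \<exists>j. \<forall>e\<in>emb d. c (\<phi> \<circ> e) = j"
  proof (rule milliken[OF d fin])
    fix e e' :: "nat list \<Rightarrow> nat list"
    assume eq: "\<And>x. x \<in> Tree d \<Longrightarrow> length x < K \<Longrightarrow> e x = e' x"
    have "e ` Q i = e' ` Q i" if "i < p" for i
      using K[OF that] QT[OF that] eq by (intro image_cong) auto
    then show "c e = c e'" by (simp add: c_def)
  qed
  then obtain \<phi> j where \<phi>: "\<phi> \<in> emb d" and j: "\<And>e. e \<in> emb d \<Longrightarrow> c (\<phi> \<circ> e) = j" by blast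
  obtain l where l: "strong_emb d l \<phi>" using \<phi> by (auto simp: emb_def)
  have sim\<phi>: "strong_similarity \<phi> DD (\<phi> ` DD)" by (rule strong_emb_similarity[OF l d DD(1)])
  have \<phi>T: "\<phi> ` DD \<subseteq> Tree d" using DD(1) strong_embD(1)[OF l] by blast
  define g where "g = \<Delta> \<circ> \<phi>"
  have g: "strong_similarity g DD (g ` DD)"
    using strong_similarity_comp[OF sim\<phi> diagonalization_similarity[OF assms(2) \<phi>T
          diagonal_similar[OF sim\<phi> DD(2)]]]
    by (simp add: g_def image_comp)
  have gD: "g ` DD \<subseteq> DD" using \<phi>T by (auto simp: g_def DD_def)
  have "\<gamma> i S = j ! i" if i: "i < p" and S: "S \<in> Sims (g ` DD) (F i)" for i S
  proof -
    from S obtain f where f: "strong_similarity f (F i) S" and SD: "S \<subseteq> g ` DD"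
      by (auto simp: Sims_def strongly_similar_def)
    \<comment> \<open>Pulling \<open>S\<close> back along \<open>g\<close> gives a copy inside
      \<open>DD\<close>, hence of the form \<open>e\<close> followed by \<open>Q i\<close>; the
      colour of \<open>S\<close> is then the constant one for
      \<open>\<phi> \<circ> e\<close>.\<close>
    define S' where "S' = inv_into DD g ` S"
    have "S' \<subseteq> DD" using SD by (auto simp: S'_def intro: inv_into_into)
    moreover have "strongly_similar (F i) S'"
      using strong_similarity_comp[OF f strong_similarity_inverse[OF g SD]]
      by (auto simp: strongly_similar_def S'_def)
    ultimately have "S' \<in> Sims DD (F i)" by (simp add: Sims_def)
    then obtain e where e: "e \<in> emb d" "e ` Q i = S'" using copy[OF i] by blast
    have "g ` S' = S" using SD by (simp add: S'_def image_inv_into_cancel)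
    then have "\<Delta> ` (\<phi> \<circ> e) ` Q i = S" by (simp add: g_def image_image flip: e(2))
    then have "min (\<gamma> i S) (m i) = j ! i" using j[OF e(1)] i by (auto simp: c_def)
    moreover have "S \<in> Sims (\<Delta> ` Tree d) (F i)" using S gD by (auto simp: Sims_def DD_def)
    then have "\<gamma> i S < m i" using assms(5)[OF i] by auto
    ultimately show ?thesis by simp
  qed
  then show ?thesis using g gD unfolding DD_def by blast
qed

end
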